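(* Let $(\Omega,\mathcal F,\mathbb P,\theta)$ be an ergodic metric dynamical system with time set $\mathbb R$, $H$ a separable Hilbert space, and $U$ the linear random dynamical system on $H$ generated by $\frac{du}{dt}+A(\theta_t\omega)u=0$. Assume: (A) $U$ is nonuniformly pseudo-hyperbolic, with invariant set $\tilde\Omega$, splitting $H=E^s(\omega)\oplus E^u(\omega)$, projections $\Pi^s,\Pi^u$, $\theta$-invariant random variables $\alpha(\omega)>\beta(\omega)$ and tempered $K:\tilde\Omega\to[1,\infty)$ (see context). (B) There are a random variable $\rho_0:\Omega\to(0,\infty)$ tempered from below with $t\mapsto\rho_0(\theta_t\omega)$ locally integrable, a number $\varepsilon\in(0,1]$, and a random variable $\tilde B_1$ tempered from above with $t\mapsto\tilde B_1(\theta_t\omega)$ locally integrable, such that, with $\mathcal N(\omega)=\{u\in H:\|u\|<\rho_0(\omega)\}$, the map $F(\omega,\cdot):\mathcal N(\omega)\to H$ (measurable in $\omega$) is Lipschitz continuous, $F(\omega,0)=0$ and $$\|F(\omega,u)-F(\omega,v)\|\le\tilde B_1(\omega)\big(\|u\|^\varepsilon+\|v\|^\varepsilon\big)\|u-v\|,\qquad \omega\in\Omega,\ u,v\in\mathcal N(\omega).$$ Let $\rho:\Omega\to(0,\infty)$ be a random variable tempered from below with $t\mapsto\rho(\theta_t\omega)$ locally integrable and $2\rho\le\rho_0$, let $F_\rho$ be the cut-off of $F$ (see context), let $B_1>0$ be a random variable tempered from above, with $t\mapsto B_1(\theta_t\omega)$ locally integrable, such that $\|F_\rho(\omega,u)-F_\rho(\omega,v)\|\le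 B_1(\omega)\rho(\omega)^\varepsilon\|u-v\|$ for all $u,v\in H$, and suppose $$0<\rho(\omega)<\Big(\frac{\alpha(\omega)-\beta(\omega)}{8K(\omega)B_1(\omega)}\Big)^{1/\varepsilon}.$$ Then the equation $\frac{du}{dt}+A(\theta_t\omega)u=F_\rho(\theta_t\omega,u)$ has a Lipschitz pseudo-unstable manifold: for every $\omega$ in a $\theta$-invariant set of full measure, the set $M^u(\omega)$ (defined in the context) satisfies $$M^u(\omega)=\{p+h^u(\omega,p)\ :\ p\in E^u(\omega)\},$$ where $h^u(\omega,\cdot):E^u(\omega)\to E^s(\omega)$ is Lipschitz continuous and $h^u(\omega,0)=0$.
   Context: Metric dynamical system: a probability space $(\Omega,\mathcal F,\mathbb P)$ with a measurable flow $\theta:\mathbb R\times\Omega\to\Omega$ ($\theta_0=\mathrm{id}$, $\theta_t\theta_s=\theta_{t+s}$) under which $\mathbb P$ is invariant and ergodic. Linear random dynamical system generated by the linear equation: bounded linear operators $U(t,\omega)$ on $H$, $t\ge0$, jointly measurable in $(t,\omega,x)$, with $U(0,\omega)=\mathrm{id}$ and $U(t+\tau,\omega)=U(t,\theta_\tau\omega)U(\tau,\omega)$, such that $U_\omega(t,s):=U(t-s,\theta_s\omega)$, $t\ge s$, is the fundamental solution (evolution operator) of $\frac{du}{dt}+A(\theta_t\omega)u=0$; in particular $(t,s)\mapsto U_\omega(t,s)x$ is continuous for every $x\in H$. Solutions of nonlinear equations $\frac{du}{dt}+A(\theta_t\omega)u=G(\theta_t\omega,u)$ are mild solutions: $u(t)=U(t-s,\theta_s\omega)u(s)+\int_s^tU(t-\tau,\theta_\tau\omega)G(\theta_\tau\omega,u(\tau))\,d\tau$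 for $s\le t$. Tempered (from above): $X:\Omega\to(0,\infty)$ is tempered if $\lim_{t\to\infty}\frac{\log^+X(\theta_t\omega)}t=0$ on a $\theta$-invariant set of full measure; tempered from below means $X^{-1}$ is tempered. Nonuniformly pseudo-hyperbolic: there is a $\theta$-invariant set $\tilde\Omega\subset\Omega$ of full measure such that for each $\omega\in\tilde\Omega$, $H=E^s(\omega)\oplus E^u(\omega)$ with closed subspaces satisfying: (i) for $t\ge0$, $U(t,\omega)E^s(\omega)\subset E^s(\theta_t\omega)$, $U(t,\omega)E^u(\omega)\subset E^u(\theta_t\omega)$, and $U(t,\omega)|_{E^u(\omega)}$ is an isomorphism from $E^u(\omega)$ to $E^u(\theta_t\omega)$; (ii) there are $\theta$-invariant random variables $\alpha(\omega)>\beta(\omega)$ and a tempered random variable $K:\tilde\Omega\to[1,\infty)$ with $$\|U(t,\omega)\Pi^s(\omega)\|\le K(\omega)e^{\beta(\omega)t}\ (t\ge0),\qquad \big\|\big(U(-t,\theta_t\omega)|_{E^u(\theta_t\omega)}\big)^{-1}\Pi^u(\omega)\big\|\le K(\omega)e^{\alpha(\omega)t}\ (t\le0),$$ where $\Pi^s(\omega),\Pi^u(\omega)$ are the measurable projections associated with the splitting. Cut-off: fix a $C^\infty$ function $\sigma:\mathbb R\to[0,1]$ with $\sigma(s)=1$ for $|s|\le1$, $\sigma(s)=0$ for $|s|\ge2$, $\sup|\sigma'|\le2$, and set $F_\rho(\omega,u)=\sigma(\|u\|/\rho(\omega))F(\omega,u)$ (interpreted as $0$ where $\|u\|\ge2\rho(\omega)$).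 Pseudo-unstable set: let $\gamma(\omega)=\frac{\alpha(\omega)+\beta(\omega)}2$ and let $C_\gamma^-$ be the Banach space of continuous $u:(-\infty,0]\to H$ with $\sup_{t\le0}\|e^{-\gamma(\omega)t}u(t)\|<\infty$. $M^u(\omega)$ is the set of $u^0\in H$ for which there is a solution $u$ of $\frac{du}{dt}+A(\theta_t\omega)u=F_\rho(\theta_t\omega,u)$ defined for all $t\le0$ with $u(0)=u^0$ and $u\in C_\gamma^-$. It is called a Lipschitz pseudo-unstable manifold if it is the graph of a Lipschitz function. *)

theory Defs
  imports "HOL-Probability.Probability"
begin

section \<open>Ergodic metric dynamical systems\<close>

definition flow_invariant :: "'w measure \<Rightarrow> (real \<Rightarrow> 'w \<Rightarrow> 'w) \<Rightarrow> 'w set \<Rightarrow> bool" where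
  "flow_invariant M \<theta> A \<longleftrightarrow> A \<subseteq> space M \<and> (\<forall>t. \<theta> t -` A \<inter> space M = A)"

locale ergodic_mds = prob_space M for M :: "'w measure" +
  fixes \<theta> :: "real \<Rightarrow> 'w \<Rightarrow> 'w"
  assumes measurable_flow: "(\<lambda>(t, \<omega>). \<theta> t \<omega>) \<in> (borel \<Otimes>\<^sub>M M) \<rightarrow>\<^sub>M M"
    and flow_zero: "\<omega> \<in> space M \<Longrightarrow> \<theta> 0 \<omega> = \<omega>"
    and flow_add: "\<omega> \<in> space M \<Longrightarrow> \<theta> (t + s) \<omega> = \<theta> t (\<theta> s \<omega>)"
    and measure_invariant: "distr M M (\<theta> t) = M"
    and ergodic: "A \<in> sets M \<Longrightarrow> flow_invariant M \<theta> A \<Longrightarrow> prob A = 0 \<or> prob A = 1"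

definition full_invariant :: "'w measure \<Rightarrow> (real \<Rightarrow> 'w \<Rightarrow> 'w) \<Rightarrow> 'w set \<Rightarrow> bool" where
  "full_invariant M \<theta> A \<longleftrightarrow> A \<in> sets M \<and> flow_invariant M \<theta> A \<and> measure M A = 1"

text \<open>The set \<open>D\<close> is the domain of the random variable \<open>X\<close>: it is \<open>space M\<close>, or an
  invariant set of full measure for variables that are only defined there.\<close>

definition tempered_above ::
    "'w measure \<Rightarrow> (real \<Rightarrow> 'w \<Rightarrow> 'w) \<Rightarrow> 'w set \<Rightarrow> ('w \<Rightarrow> real) \<Rightarrow> bool" where
  "tempered_above M \<theta> D X \<longleftrightarrow>
     X \<in> borel_measurable (restrict_space M D) \<and> (\<forall>\<omega>\<in>D. 0 < X \<omega>) \<and>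
     (\<exists>A\<subseteq>D. full_invariant M \<theta> A \<and>
        (\<forall>\<omega>\<in>A. ((\<lambda>t. max 0 (ln (X (\<theta> t \<omega>))) / t) \<longlongrightarrow> 0) at_top))"

definition tempered_below ::
    "'w measure \<Rightarrow> (real \<Rightarrow> 'w \<Rightarrow> 'w) \<Rightarrow> 'w set \<Rightarrow> ('w \<Rightarrow> real) \<Rightarrow> bool" where
  "tempered_below M \<theta> D X \<longleftrightarrow>
     X \<in> borel_measurable (restrict_space M D) \<and> (\<forall>\<omega>\<in>D. 0 < X \<omega>) \<and>
     tempered_above M \<theta> D (\<lambda>\<omega>. inverse (X \<omega>))"

definition orbit_locally_integrable ::
    "'w measure \<Rightarrow> (real \<Rightarrow> 'w \<Rightarrow> 'w) \<Rightarrow> ('w \<Rightarrow> real) \<Rightarrow> bool" where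
  "orbit_locally_integrable M \<theta> X \<longleftrightarrow>
     (\<forall>\<omega>\<in>space M. \<forall>a b. set_integrable lborel {a..b} (\<lambda>t. X (\<theta> t \<omega>)))"


section \<open>The linear random dynamical system\<close>

text \<open>\<open>v\<close> solves \<open>dv/dt + A(t) v = 0\<close> for \<open>t > s\<close>, where \<open>A t\<close> is a linear operator with
  domain \<open>D t\<close>. The equation is integrated in time over compact subintervals of \<open>(s, \<infinity>)\<close>, so
  that neither continuity of the coefficients in time nor regularity at the initial time is
  imposed; classical solutions on \<open>(s, \<infinity>)\<close> and Caratheodory solutions are both included.\<close>

definition solves_linear_after ::
    "(real \<Rightarrow> 'h set) \<Rightarrow> (real \<Rightarrow> 'h \<Rightarrow> 'h) \<Rightarrow> real \<Rightarrow>
     (real \<Rightarrow> 'h::{real_inner,banach,second_countable_topology}) \<Rightarrow> bool" where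
  "solves_linear_after D A s v \<longleftrightarrow>
     (AE \<tau> in lborel. s < \<tau> \<longrightarrow> v \<tau> \<in> D \<tau>) \<and>
     (\<forall>r t. s < r \<longrightarrow> r \<le> t \<longrightarrow>
        set_integrable lebesgue {r..t} (\<lambda>\<tau>. A \<tau> (v \<tau>)) \<and>
        v t = v r - (LINT \<tau>:{r..t}|lebesgue. A \<tau> (v \<tau>)))"

definition linear_operator_with_domain ::
    "'h::real_vector set \<Rightarrow> ('h \<Rightarrow> 'h) \<Rightarrow> bool" where
  "linear_operator_with_domain D A \<longleftrightarrow> subspace D \<and>
     (\<forall>x\<in>D. \<forall>y\<in>D. A (x + y) = A x + A y) \<and> (\<forall>c. \<forall>x\<in>D. A (c *\<^sub>R x) = c *\<^sub>R A x)"

text \<open>An evolution operator \<open>V t s\<close>, \<open>s \<le> t\<close>, whose trajectories solve the equation for a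
  dense set of initial values. For unbounded \<open>A\<close> the trajectory of an arbitrary initial value
  need not enter the domains.\<close>

definition fundamental_solution ::
    "(real \<Rightarrow> 'h set) \<Rightarrow> (real \<Rightarrow> 'h \<Rightarrow> 'h) \<Rightarrow>
     (real \<Rightarrow> real \<Rightarrow> 'h::{real_inner,banach,second_countable_topology} \<Rightarrow>\<^sub>L 'h) \<Rightarrow> bool" where
  "fundamental_solution D A V \<longleftrightarrow>
     (\<forall>x. continuous_on {(t, s). s \<le> t} (\<lambda>(t, s). blinfun_apply (V t s) x)) \<and>
     (\<forall>s. V s s = id_blinfun) \<and>
     (\<forall>r s t. r \<le> s \<longrightarrow> s \<le> t \<longrightarrow> V t r = V t s o\<^sub>L V s r) \<and>
     (\<forall>s. closure {x. solves_linear_after D A s (\<lambda>t. blinfun_apply (V t s) x)} = UNIV)"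

text \<open>\<open>U t \<omega>\<close> is meaningful for \<open>0 \<le> t\<close> only.\<close>

definition generated_linear_rds ::
    "'w measure \<Rightarrow> (real \<Rightarrow> 'w \<Rightarrow> 'w) \<Rightarrow> ('w \<Rightarrow> 'h set) \<Rightarrow> ('w \<Rightarrow> 'h \<Rightarrow> 'h) \<Rightarrow>
     (real \<Rightarrow> 'w \<Rightarrow> 'h::{real_inner,banach,second_countable_topology} \<Rightarrow>\<^sub>L 'h) \<Rightarrow> bool" where
  "generated_linear_rds M \<theta> domA A U \<longleftrightarrow>
     (\<lambda>(t, \<omega>, x). blinfun_apply (U t \<omega>) x)
        \<in> borel_measurable (restrict_space borel {0..} \<Otimes>\<^sub>M M \<Otimes>\<^sub>M borel) \<and>
     (\<forall>\<omega>\<in>space M.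
        linear_operator_with_domain (domA \<omega>) (A \<omega>) \<and>
        U 0 \<omega> = id_blinfun \<and>
        (\<forall>t\<ge>0. \<forall>\<tau>\<ge>0. U (t + \<tau>) \<omega> = U t (\<theta> \<tau> \<omega>) o\<^sub>L U \<tau> \<omega>) \<and>
        fundamental_solution (\<lambda>t. domA (\<theta> t \<omega>)) (\<lambda>t. A (\<theta> t \<omega>)) (\<lambda>t s. U (t - s) (\<theta> s \<omega>)))"


section \<open>Nonuniform pseudo-hyperbolicity\<close>

definition closed_splitting :: "'h::real_normed_vector set \<Rightarrow> 'h set \<Rightarrow> bool" where
  "closed_splitting E F \<longleftrightarrow> subspace E \<and> closed E \<and> subspace F \<and> closed F \<and>
     E \<inter> F = {0} \<and> (\<forall>x. \<exists>y\<in>E. \<exists>z\<in>F. x = y + z)"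

definition splitting_projections ::
    "'h::real_normed_vector set \<Rightarrow> 'h set \<Rightarrow> ('h \<Rightarrow>\<^sub>L 'h) \<Rightarrow> ('h \<Rightarrow>\<^sub>L 'h) \<Rightarrow> bool" where
  "splitting_projections E F P Q \<longleftrightarrow>
     (\<forall>x. blinfun_apply P x \<in> E \<and> blinfun_apply Q x \<in> F \<and>
          blinfun_apply P x + blinfun_apply Q x = x)"

text \<open>That \<open>U t \<omega>\<close> restricts to an isomorphism of \<open>Eu \<omega>\<close> onto \<open>Eu (\<theta> t \<omega>)\<close> means that this
  linear map is a homeomorphism between the two subspaces; hence the operator whose \<^const>\<open>onorm\<close>
  is taken below is bounded.\<close>

definition pseudo_hyperbolic ::
    "'w measure \<Rightarrow> (real \<Rightarrow> 'w \<Rightarrow> 'w) \<Rightarrow>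
     (real \<Rightarrow> 'w \<Rightarrow> 'h::{real_inner,banach,second_countable_topology} \<Rightarrow>\<^sub>L 'h) \<Rightarrow> 'w set \<Rightarrow>
     ('w \<Rightarrow> 'h set) \<Rightarrow> ('w \<Rightarrow> 'h set) \<Rightarrow> ('w \<Rightarrow> 'h \<Rightarrow>\<^sub>L 'h) \<Rightarrow> ('w \<Rightarrow> 'h \<Rightarrow>\<^sub>L 'h) \<Rightarrow>
     ('w \<Rightarrow> real) \<Rightarrow> ('w \<Rightarrow> real) \<Rightarrow> ('w \<Rightarrow> real) \<Rightarrow> bool" where
  "pseudo_hyperbolic M \<theta> U \<Omega>' Es Eu Ps Pu \<alpha> \<beta> K \<longleftrightarrow>
     full_invariant M \<theta> \<Omega>' \<and>
     \<alpha> \<in> borel_measurable (restrict_space M \<Omega>') \<and>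
     \<beta> \<in> borel_measurable (restrict_space M \<Omega>') \<and>
     (\<forall>x. (\<lambda>\<omega>. blinfun_apply (Ps \<omega>) x) \<in> borel_measurable (restrict_space M \<Omega>')) \<and>
     (\<forall>x. (\<lambda>\<omega>. blinfun_apply (Pu \<omega>) x) \<in> borel_measurable (restrict_space M \<Omega>')) \<and>
     tempered_above M \<theta> \<Omega>' K \<and>
     (\<forall>\<omega>\<in>\<Omega>'.
        closed_splitting (Es \<omega>) (Eu \<omega>) \<and>
        splitting_projections (Es \<omega>) (Eu \<omega>) (Ps \<omega>) (Pu \<omega>) \<and>
        (\<forall>t\<ge>0. blinfun_apply (U t \<omega>) ` Es \<omega> \<subseteq> Es (\<theta> t \<omega>) \<and>
               blinfun_apply (U t \<omega>) ` Eu \<omega> \<subseteq> Eu (\<theta> t \<omega>) \<and>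
               homeomorphism (Eu \<omega>) (Eu (\<theta> t \<omega>)) (blinfun_apply (U t \<omega>))
                 (inv_into (Eu \<omega>) (blinfun_apply (U t \<omega>)))) \<and>
        (\<forall>t. \<alpha> (\<theta> t \<omega>) = \<alpha> \<omega> \<and> \<beta> (\<theta> t \<omega>) = \<beta> \<omega>) \<and>
        \<beta> \<omega> < \<alpha> \<omega> \<and> 1 \<le> K \<omega> \<and>
        (\<forall>t\<ge>0. norm (U t \<omega> o\<^sub>L Ps \<omega>) \<le> K \<omega> * exp (\<beta> \<omega> * t)) \<and>
        (\<forall>t\<le>0. onorm (\<lambda>x. inv_into (Eu (\<theta> t \<omega>)) (blinfun_apply (U (- t) (\<theta> t \<omega>)))
                               (blinfun_apply (Pu \<omega>) x))
                 \<le> K \<omega> * exp (\<alpha> \<omega> * t)))"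


section \<open>Cut-off nonlinearity and the pseudo-unstable set\<close>

definition cutoff_function :: "(real \<Rightarrow> real) \<Rightarrow> bool" where
  "cutoff_function \<sigma> \<longleftrightarrow>
     (\<forall>k x. (deriv ^^ k) \<sigma> differentiable (at x)) \<and>
     (\<forall>s. 0 \<le> \<sigma> s \<and> \<sigma> s \<le> 1) \<and>
     (\<forall>s. \<bar>s\<bar> \<le> 1 \<longrightarrow> \<sigma> s = 1) \<and> (\<forall>s. 2 \<le> \<bar>s\<bar> \<longrightarrow> \<sigma> s = 0) \<and>
     (\<forall>s. \<bar>deriv \<sigma> s\<bar> \<le> 2)"

definition cutoff ::
    "(real \<Rightarrow> real) \<Rightarrow> ('w \<Rightarrow> real) \<Rightarrow> ('w \<Rightarrow> 'h \<Rightarrow> 'h::real_normed_vector) \<Rightarrow> 'w \<Rightarrow> 'h \<Rightarrow> 'h" where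
  "cutoff \<sigma> \<rho> F \<omega> u = (if norm u < 2 * \<rho> \<omega> then \<sigma> (norm u / \<rho> \<omega>) *\<^sub>R F \<omega> u else 0)"

text \<open>Mild solutions of \<open>du/dt + A(\<theta>\<^sub>t \<omega>) u = G(\<theta>\<^sub>t \<omega>, u)\<close> on \<open>(-\<infinity>, 0]\<close>; \<open>A\<close> enters through
  the random dynamical system \<open>U\<close> it generates. Values of \<open>u\<close> at positive times are irrelevant
  here and in the next two definitions.\<close>

definition mild_solution_backward ::
    "(real \<Rightarrow> 'w \<Rightarrow> 'w) \<Rightarrow>
     (real \<Rightarrow> 'w \<Rightarrow> 'h::{real_inner,banach,second_countable_topology} \<Rightarrow>\<^sub>L 'h) \<Rightarrow>
     ('w \<Rightarrow> 'h \<Rightarrow> 'h) \<Rightarrow> 'w \<Rightarrow> (real \<Rightarrow> 'h) \<Rightarrow> bool" where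
  "mild_solution_backward \<theta> U G \<omega> u \<longleftrightarrow>
     (\<forall>s t. s \<le> t \<longrightarrow> t \<le> 0 \<longrightarrow>
        set_integrable lborel {s..t} (\<lambda>\<tau>. blinfun_apply (U (t - \<tau>) (\<theta> \<tau> \<omega>)) (G (\<theta> \<tau> \<omega>) (u \<tau>))) \<and>
        u t = blinfun_apply (U (t - s) (\<theta> s \<omega>)) (u s)
            + (LINT \<tau>:{s..t}|lborel. blinfun_apply (U (t - \<tau>) (\<theta> \<tau> \<omega>)) (G (\<theta> \<tau> \<omega>) (u \<tau>))))"

definition weighted_space :: "real \<Rightarrow> (real \<Rightarrow> 'h::real_normed_vector) set" where
  "weighted_space \<gamma> =
     {u. continuous_on {..0} u \<and> bounded ((\<lambda>t. exp (- \<gamma> * t) *\<^sub>R u t) ` {..0})}"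

definition pseudo_unstable_set ::
    "(real \<Rightarrow> 'w \<Rightarrow> 'w) \<Rightarrow>
     (real \<Rightarrow> 'w \<Rightarrow> 'h::{real_inner,banach,second_countable_topology} \<Rightarrow>\<^sub>L 'h) \<Rightarrow>
     ('w \<Rightarrow> 'h \<Rightarrow> 'h) \<Rightarrow> ('w \<Rightarrow> real) \<Rightarrow> 'w \<Rightarrow> 'h set" where
  "pseudo_unstable_set \<theta> U G \<gamma> \<omega> =
     {u0. \<exists>u. mild_solution_backward \<theta> U G \<omega> u \<and> u 0 = u0 \<and> u \<in> weighted_space (\<gamma> \<omega>)}"

end

theory Submission
  imports Defs
begin

text \<open>Multiplied by \<open>exp (- \<gamma> t)\<close>, the solutions in question become the bounded backward solutions of
  an equation with an exponential dichotomy. They are exactly the fixed points of the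
  Lyapunov--Perron operator \<open>u \<mapsto> R t 0 \<xi> + \<integral> green t \<tau> (G \<tau> (u \<tau>)) d\<tau>\<close> over \<open>\<tau> \<le> 0\<close>, which is a contraction
  with constant \<open>1/2\<close> because the factor \<open>K\<close> in the dichotomy bounds cancels against the \<open>K\<close> in the
  smallness condition on \<open>\<rho>\<close>. That every bounded solution is such a fixed point requires
  \<open>K (\<theta> s \<omega>) exp (\<delta> s)\<close> to become small for some \<open>s \<rightarrow> -\<infinity>\<close>, whereas temperedness only concerns
  \<open>s \<rightarrow> \<infinity>\<close>; it follows from the invariance of the measure, which makes \<open>\<integral> 1 / K (\<theta> t \<omega>) dt\<close> over \<open>t \<le> 0\<close>
  infinite almost surely.\<close>

section \<open>The Lyapunov--Perron operator of an exponential dichotomy\<close>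

text \<open>Since \<gamma> is the midpoint of \<beta> and \<alpha>, both weighted rates equal
  \<delta>, half the gap. The Lipschitz constant (\<alpha> - \<beta>) / (8 K) is then \<delta> / (4
  K), and the kernel exp (- \<delta> |t - \<tau>|) has mass 2 / \<delta>: this is where 8 and 1/2
  come from. The factors K match exactly because both dichotomy bounds carry K at the time \<tau> at
  which \<open>G\<close> acts, so the contraction is settled at each \<tau> separately. The
  behaviour of K along the orbit enters at one point. A bounded solution and its image under the
  operator differ by a bounded orbit of the linear equation without unstable part. Its stable part
  at t is at most a constant times K (\<theta> s \<omega>) exp (\<delta> s) for every s \<le> t, so
  smallness at some s is enough and no limit is required. Were this quantity at least some e > 0 for
  all early s, then 1 / K would be integrable over the past. Stable vectors need not have backward
  orbits. All backward motion therefore goes through the inverse \<open>R\<close> on the unstable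
  subspaces, and the regularity of \<open>R\<close> is drawn from the forward evolution
  \<open>V\<close>.\<close>

lemma has_bochner_integral_exp_abs:
  fixes \<delta> t :: real
  assumes "0 < \<delta>"
  shows "has_bochner_integral lborel (\<lambda>\<tau>. exp (- \<delta> * \<bar>t - \<tau>\<bar>)) (2 / \<delta>)"
proof -
  let ?f = "\<lambda>x::real. indicator {0<..} x * exp (- (x * \<delta>))"
  have f: "has_bochner_integral lborel ?f (1 / \<delta>)"
    using integrable_I0i_exp_mscale[OF assms] LBINT_I0i_exp_mscale[OF assms]
    by (simp add: has_bochner_integral_iff set_integrable_def interval_lebesgue_integral_0_infty
        set_lebesgue_integral_def)
  have "has_bochner_integral lborel (\<lambda>x. ?f (- t + 1 * x)) ((1 / \<delta>) /\<^sub>R \<bar>1\<bar>)"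
    by (rule lborel_has_bochner_integral_real_affine_iff[THEN iffD1, OF _ f]) simp
  moreover have "has_bochner_integral lborel (\<lambda>x. ?f (t + (- 1) * x)) ((1 / \<delta>) /\<^sub>R \<bar>- 1\<bar>)"
    by (rule lborel_has_bochner_integral_real_affine_iff[THEN iffD1, OF _ f]) simp
  ultimately have "has_bochner_integral lborel (\<lambda>x. ?f (x - t) + ?f (t - x)) (1 / \<delta> + 1 / \<delta>)"
    by (intro has_bochner_integral_add) simp_all
  \<comment> \<open>At \<open>x = t\<close> both indicators vanish while the exponential is 1, so
    the two halves add up to the kernel only off that point.\<close>
  moreover have "AE x in lborel. ?f (x - t) + ?f (t - x) = exp (- \<delta> * \<bar>t - x\<bar>)"
    using AE_lborel_singleton[of t] by eventually_elim (auto simp: indicator_def mult.commute)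
  ultimately show ?thesis
    by (subst has_bochner_integral_cong_AE[symmetric]) auto
qed

text \<open>\<open>V t s\<close>, \<open>s \<le> t\<close>, is the evolution operator and \<open>R t s\<close>, \<open>t \<le> s\<close>, the inverse of its
  restriction to the unstable subspaces, composed with the projection \<open>Q s\<close>. Time is rescaled so
  that the weight \<open>\<gamma>\<close> is \<open>0\<close>.\<close>

locale backward_dichotomy =
  fixes V R :: "real \<Rightarrow> real \<Rightarrow> 'h::{banach,second_countable_topology} \<Rightarrow>\<^sub>L 'h"
    and P Q :: "real \<Rightarrow> 'h \<Rightarrow>\<^sub>L 'h" and G :: "real \<Rightarrow> 'h \<Rightarrow> 'h" and K :: "real \<Rightarrow> real"
    and \<delta> :: real
  assumes delta_pos: "0 < \<delta>" and K_pos: "\<And>t. 0 < K t"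
    and V_id: "\<And>t x. V t t x = x"
    and V_comp: "\<And>r s t x. r \<le> s \<Longrightarrow> s \<le> t \<Longrightarrow> V t s (V s r x) = V t r x"
    and V_cont: "\<And>s x. continuous_on {s..} (\<lambda>t. V t s x)"
    and PQ: "\<And>t x. P t x + Q t x = x"
    and PV: "\<And>s t x. s \<le> t \<Longrightarrow> P t (V t s x) = V t s (P s x)"
    and VR: "\<And>s t x. t \<le> s \<Longrightarrow> V s t (R t s x) = Q s x"
    and RV: "\<And>s t x. t \<le> s \<Longrightarrow> R t s (V s t x) = Q t x"
    and QR: "\<And>s t x. t \<le> s \<Longrightarrow> Q t (R t s x) = R t s x"
    and RQ: "\<And>s t x. t \<le> s \<Longrightarrow> R t s (Q s x) = R t s x"
    and norm_VP: "\<And>s t x. s \<le> t \<Longrightarrow> norm (V t s (P s x)) \<le> K s * exp (- \<delta> * (t - s)) * norm x"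
    and norm_R: "\<And>s t x. t \<le> s \<Longrightarrow> norm (R t s x) \<le> K s * exp (- \<delta> * (s - t)) * norm x"
    and G_zero: "\<And>t. G t 0 = 0"
    and G_lip: "\<And>t x y. norm (G t x - G t y) \<le> \<delta> / (4 * K t) * norm (x - y)"
    and meas_VPG: "\<And>t u. u \<in> borel_measurable borel \<Longrightarrow>
      (\<lambda>\<tau>. indicator {..t} \<tau> *\<^sub>R V t \<tau> (P \<tau> (G \<tau> (u \<tau>)))) \<in> borel_measurable borel"
    and meas_VQG: "\<And>t u. u \<in> borel_measurable borel \<Longrightarrow>
      (\<lambda>\<tau>. indicator {..t} \<tau> *\<^sub>R V t \<tau> (Q \<tau> (G \<tau> (u \<tau>)))) \<in> borel_measurable borel"
    and K_sub: "\<And>t e. 0 < e \<Longrightarrow> \<exists>s\<le>t. K s * exp (\<delta> * s) < e"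
begin

section \<open>Algebra of the evolution, its unstable inverse and the projections\<close>

lemma QV: "s \<le> t \<Longrightarrow> Q t (V t s x) = V t s (Q s x)"
proof -
  assume st: "s \<le> t"
  have "P t (V t s x) + Q t (V t s x) = V t s (P s x) + V t s (Q s x)"
    using PQ[of t "V t s x"] PQ[of s x] by (simp flip: blinfun.add_right)
  then show ?thesis using PV[OF st] by simp
qed

lemma R_id: "R t t x = Q t x"
  using RV[of t t x] by (simp add: V_id)

lemma Q_idem: "Q t (Q t x) = Q t x"
  using QR[of t t x] by (simp add: R_id)

text \<open>The locale assumes neither a composition law nor continuity for \<open>R\<close> in its
  first argument. This identity presents \<open>t \<mapsto> R t r x\<close> as a forward orbit
  started at the earlier time \<open>s\<close>, so that both are inherited from \<open>V\<close>. It
  holds because \<open>R t r\<close> undoes \<open>V r t\<close> up to the projection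
  \<open>Q t\<close>, which does not affect an unstable vector.\<close>

lemma VR_comp: "s \<le> t \<Longrightarrow> t \<le> r \<Longrightarrow> V t s (R s r x) = R t r x"
proof -
  assume *: "s \<le> t" "t \<le> r"
  have "R t r x = R t r (V r s (R s r x))" using * by (simp add: VR RQ)
  also have "\<dots> = R t r (V r t (V t s (R s r x)))" using * by (simp add: V_comp)
  also have "\<dots> = V t s (R s r x)" using * by (simp add: RV QV QR)
  finally show ?thesis ..
qed

text \<open>With \<open>s\<close> fixed, \<tau> occurs on the right only in
  \<open>V s \<tau>\<close> and \<open>Q \<tau>\<close>, where measurability in \<tau> is available.
  This is how the unstable half of the kernel is seen to be measurable.\<close>

lemma R_via: "t \<le> \<tau> \<Longrightarrow> \<tau> \<le> s \<Longrightarrow> R t \<tau> x = R t s (V s \<tau> (Q \<tau> x))"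
proof -
  assume *: "t \<le> \<tau>" "\<tau> \<le> s"
  have "R t s (V s \<tau> (Q \<tau> x)) = R t s (V s \<tau> (V \<tau> t (R t \<tau> x)))" using * by (simp add: VR)
  also have "\<dots> = R t \<tau> x" using * by (simp add: V_comp RV QR)
  finally show ?thesis ..
qed

text \<open>The Green's function of the dichotomy: the stable part of a source at \<tau> is carried
  forward, the unstable part backward with a minus sign, so that both halves decay away from \<tau>.
  The value on the diagonal matters only on a null set.\<close>

definition green :: "real \<Rightarrow> real \<Rightarrow> 'h \<Rightarrow> 'h" where
  "green t \<tau> x = (if \<tau> < t then V t \<tau> (P \<tau> x) else - R t \<tau> x)"

lemma green_diff: "green t \<tau> (x - y) = green t \<tau> x - green t \<tau> y"
  by (simp add: green_def blinfun.diff_right)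

lemma norm_green: "norm (green t \<tau> x) \<le> K \<tau> * exp (- \<delta> * \<bar>t - \<tau>\<bar>) * norm x"
  using norm_VP[of \<tau> t x] norm_R[of t \<tau> x] by (auto simp: green_def abs_if)

text \<open>\<open>norm_green\<close> carries \<open>K\<close> at the source time \<tau>, the time
  at which \<open>G\<close> is evaluated, so it cancels against the denominator in
  \<open>G_lip\<close>.\<close>

lemma norm_green_G:
  "norm (green t \<tau> (G \<tau> x - G \<tau> y)) \<le> \<delta> / 4 * norm (x - y) * exp (- \<delta> * \<bar>t - \<tau>\<bar>)"
proof -
  have "norm (green t \<tau> (G \<tau> x - G \<tau> y)) \<le> K \<tau> * exp (- \<delta> * \<bar>t - \<tau>\<bar>) * norm (G \<tau> x - G \<tau> y)"
    by (rule norm_green)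
  also have "\<dots> \<le> K \<tau> * exp (- \<delta> * \<bar>t - \<tau>\<bar>) * (\<delta> / (4 * K \<tau>) * norm (x - y))"
    using K_pos[of \<tau>] by (intro mult_left_mono G_lip) auto
  also have "\<dots> = \<delta> / 4 * norm (x - y) * exp (- \<delta> * \<bar>t - \<tau>\<bar>)"
    using K_pos[of \<tau>] by simp
  finally show ?thesis .
qed

lemma norm_green_G0: "norm (green t \<tau> (G \<tau> x)) \<le> \<delta> / 4 * norm x * exp (- \<delta> * \<bar>t - \<tau>\<bar>)"
  using norm_green_G[of t \<tau> x 0] by (simp add: G_zero)

lemma meas_green:
  assumes t: "t \<le> 0" and u: "continuous_on {..0} u"
  shows "(\<lambda>\<tau>. indicator {..0} \<tau> *\<^sub>R green t \<tau> (G \<tau> (u \<tau>))) \<in> borel_measurable borel"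
proof -
  \<comment> \<open>\<open>u\<close> is continuous on \<open>{..0}\<close> only. Freezing it at
    positive times gives a Borel function on the line that agrees with \<open>u\<close> wherever the
    indicator is not 0.\<close>
  define v where "v \<tau> = u (min \<tau> 0)" for \<tau>
  have "continuous_on UNIV v"
    unfolding v_def by (intro continuous_on_compose2[OF u] continuous_intros) auto
  then have v: "v \<in> borel_measurable borel" by (rule borel_measurable_continuous_onI)
  have [measurable]: "(\<lambda>\<tau>. indicator {..t} \<tau> *\<^sub>R V t \<tau> (P \<tau> (G \<tau> (v \<tau>)))) \<in> borel_measurable borel"
    by (rule meas_VPG[OF v])
  have "(\<lambda>\<tau>. R t 0 (indicator {..0} \<tau> *\<^sub>R V 0 \<tau> (Q \<tau> (G \<tau> (v \<tau>))))) \<in> borel_measurable borel"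
    by (rule borel_measurable_continuous_on[OF _ meas_VQG[OF v]]) (intro continuous_intros)
  then have [measurable]:
    "(\<lambda>\<tau>. R t 0 (indicator {..0} \<tau> *\<^sub>R V 0 \<tau> (Q \<tau> (G \<tau> (v \<tau>))))) \<in> borel_measurable borel" .
  have "(\<lambda>\<tau>. indicator {..0} \<tau> *\<^sub>R green t \<tau> (G \<tau> (u \<tau>))) =
     (\<lambda>\<tau>. indicator {..<t} \<tau> *\<^sub>R (indicator {..t} \<tau> *\<^sub>R V t \<tau> (P \<tau> (G \<tau> (v \<tau>))))
        - indicator {t..0} \<tau> *\<^sub>R R t 0 (indicator {..0} \<tau> *\<^sub>R V 0 \<tau> (Q \<tau> (G \<tau> (v \<tau>)))))"
    using t by (auto simp: fun_eq_iff indicator_def green_def v_def min_def intro: R_via)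
  also have "\<dots> \<in> borel_measurable borel" by measurable
  finally show ?thesis .
qed

context
  fixes u :: "real \<Rightarrow> 'h" and C :: real
  assumes u_cont: "continuous_on {..0} u" and u_bdd: "\<And>\<tau>. \<tau> \<le> 0 \<Longrightarrow> norm (u \<tau>) \<le> C"
begin

lemma C_nonneg: "0 \<le> C"
  using u_bdd[of 0] norm_ge_zero order_trans by blast

lemma green_bound:
  "norm (indicator {..0} \<tau> *\<^sub>R green t \<tau> (G \<tau> (u \<tau>))) \<le> \<delta> / 4 * C * exp (- \<delta> * \<bar>t - \<tau>\<bar>)"
proof (cases "\<tau> \<le> 0")
  case True
  have "norm (green t \<tau> (G \<tau> (u \<tau>))) \<le> \<delta> / 4 * norm (u \<tau>) * exp (- \<delta> * \<bar>t - \<tau>\<bar>)"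
    by (rule norm_green_G0)
  also have "\<dots> \<le> \<delta> / 4 * C * exp (- \<delta> * \<bar>t - \<tau>\<bar>)"
    using delta_pos True by (intro mult_right_mono mult_left_mono u_bdd) auto
  finally show ?thesis using True by simp
qed (use delta_pos C_nonneg in simp)

lemma green_integrable:
  assumes "t \<le> 0"
  shows "set_integrable lborel {..0} (\<lambda>\<tau>. green t \<tau> (G \<tau> (u \<tau>)))"
  unfolding set_integrable_def
proof (rule Bochner_Integration.integrable_bound)
  show "integrable lborel (\<lambda>\<tau>. \<delta> / 4 * C * exp (- \<delta> * \<bar>t - \<tau>\<bar>))"
    using has_bochner_integral_exp_abs[OF delta_pos, of t] by (auto simp: has_bochner_integral_iff)
  show "(\<lambda>\<tau>. indicator {..0} \<tau> *\<^sub>R green t \<tau> (G \<tau> (u \<tau>))) \<in> borel_measurable lborel"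
    using meas_green[OF assms u_cont] by simp
  show "AE \<tau> in lborel. norm (indicator {..0} \<tau> *\<^sub>R green t \<tau> (G \<tau> (u \<tau>)))
      \<le> norm (\<delta> / 4 * C * exp (- \<delta> * \<bar>t - \<tau>\<bar>))"
    using green_bound delta_pos C_nonneg by (simp add: abs_mult)
qed

end

text \<open>The Lyapunov--Perron operator; \<open>\<xi>\<close> prescribes the unstable component at time \<open>0\<close>.\<close>

definition lp :: "'h \<Rightarrow> (real \<Rightarrow> 'h) \<Rightarrow> real \<Rightarrow> 'h" where
  "lp \<xi> u t = R t 0 \<xi> + (LINT \<tau>:{..0}|lborel. green t \<tau> (G \<tau> (u \<tau>)))"

section \<open>Continuity and contraction of the operator\<close>

lemma tendsto_R:
  assumes "\<And>n. X n \<le> s" "X \<longlonglongrightarrow> a"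
  shows "(\<lambda>n. R (X n) s x) \<longlonglongrightarrow> R a s x"
proof -
  have as: "a \<le> s" using assms LIMSEQ_le_const2 by blast
  have ev: "\<forall>\<^sub>F n in sequentially. a - 1 \<le> X n"
    using order_tendstoD(1)[OF assms(2), of "a - 1"] by (auto elim: eventually_mono)
  \<comment> \<open>The time \<open>a - 1\<close> lies before \<open>a\<close> and eventually before
    \<open>X n\<close>, so all the vectors \<open>R (X n) s x\<close> lie on one forward orbit,
    which is continuous.\<close>
  have "((\<lambda>n. V (X n) (a - 1) (R (a - 1) s x)) \<longlonglongrightarrow> V a (a - 1) (R (a - 1) s x))"
    by (rule continuous_on_tendsto_compose[OF V_cont assms(2)]) (use ev in auto)
  moreover have "V a (a - 1) (R (a - 1) s x) = R a s x" using as by (intro VR_comp) auto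
  moreover have "\<forall>\<^sub>F n in sequentially. V (X n) (a - 1) (R (a - 1) s x) = R (X n) s x"
    using ev by eventually_elim (use assms(1) in \<open>auto intro: VR_comp\<close>)
  ultimately show ?thesis by (auto elim: Lim_transform_eventually)
qed

lemma tendsto_green:
  assumes "X \<longlonglongrightarrow> a" "\<tau> \<noteq> a"
  shows "(\<lambda>n. green (X n) \<tau> x) \<longlonglongrightarrow> green a \<tau> x"
proof (cases "\<tau> < a")
  case True
  have ev: "\<forall>\<^sub>F n in sequentially. \<tau> < X n"
    using order_tendstoD(1)[OF assms(1) True] .
  have "(\<lambda>n. V (X n) \<tau> (P \<tau> x)) \<longlonglongrightarrow> V a \<tau> (P \<tau> x)"
    by (rule continuous_on_tendsto_compose[OF V_cont assms(1)])
       (use ev True in \<open>auto elim: eventually_mono\<close>)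
  moreover have "\<forall>\<^sub>F n in sequentially. V (X n) \<tau> (P \<tau> x) = green (X n) \<tau> x"
    using ev by eventually_elim (simp add: green_def)
  ultimately show ?thesis using True by (auto simp: green_def elim: Lim_transform_eventually)
next
  case False
  then have "a < \<tau>" using assms by auto
  have ev: "\<forall>\<^sub>F n in sequentially. X n < \<tau>"
    using order_tendstoD(2)[OF assms(1) \<open>a < \<tau>\<close>] .
  \<comment> \<open>\<open>tendsto_R\<close> wants every index at most \<tau>, whereas
    \<open>X n < \<tau>\<close> is only known eventually.\<close>
  have "(\<lambda>n. min (X n) \<tau>) \<longlonglongrightarrow> min a \<tau>" by (intro tendsto_intros assms)
  then have "(\<lambda>n. R (min (X n) \<tau>) \<tau> x) \<longlonglongrightarrow> R a \<tau> x"
    using \<open>a < \<tau>\<close> by (intro tendsto_R) auto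
  then have "(\<lambda>n. - R (min (X n) \<tau>) \<tau> x) \<longlonglongrightarrow> - R a \<tau> x" by (rule tendsto_minus)
  moreover have "\<forall>\<^sub>F n in sequentially. - R (min (X n) \<tau>) \<tau> x = green (X n) \<tau> x"
    using ev by eventually_elim (simp add: green_def)
  ultimately show ?thesis using False by (auto simp: green_def elim: Lim_transform_eventually)
qed

lemma lp_cont:
  assumes u: "continuous_on {..0} u" and C: "\<And>\<tau>. \<tau> \<le> 0 \<Longrightarrow> norm (u \<tau>) \<le> C"
  shows "continuous_on {..0} (lp \<xi> u)"
proof (rule continuous_on_sequentiallyI)
  fix X :: "nat \<Rightarrow> real" and a assume X: "\<forall>n. X n \<in> {..0}" "X \<longlonglongrightarrow> a" and a: "a \<in> {..0}"
  \<comment> \<open>The dominating function must not depend on \<open>n\<close>. Once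
    \<open>X n\<close> is within 1 of \<open>a\<close>, recentring the exponential at
    \<open>a\<close> costs at most a factor \<open>exp \<delta>\<close>.\<close>
  obtain N where N: "\<And>n. N \<le> n \<Longrightarrow> \<bar>X n - a\<bar> < 1"
    using LIMSEQ_D[OF X(2), of 1] by auto
  have "(\<lambda>n. LINT \<tau>:{..0}|lborel. green (X (n + N)) \<tau> (G \<tau> (u \<tau>)))
        \<longlonglongrightarrow> (LINT \<tau>:{..0}|lborel. green a \<tau> (G \<tau> (u \<tau>)))"
    unfolding set_lebesgue_integral_def
  proof (rule integral_dominated_convergence)
    show "(\<lambda>\<tau>. indicator {..0} \<tau> *\<^sub>R green a \<tau> (G \<tau> (u \<tau>))) \<in> borel_measurable lborel"
      using a meas_green[OF _ u, of a] by simp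
    show "(\<lambda>\<tau>. indicator {..0} \<tau> *\<^sub>R green (X (n + N)) \<tau> (G \<tau> (u \<tau>))) \<in> borel_measurable lborel" for n
      using X(1) meas_green[OF _ u, of "X (n + N)"] by simp
    show "integrable lborel (\<lambda>\<tau>. \<delta> / 4 * C * exp \<delta> * exp (- \<delta> * \<bar>a - \<tau>\<bar>))"
      using has_bochner_integral_exp_abs[OF delta_pos, of a] by (auto simp: has_bochner_integral_iff)
    show "AE \<tau> in lborel. (\<lambda>n. indicator {..0} \<tau> *\<^sub>R green (X (n + N)) \<tau> (G \<tau> (u \<tau>)))
            \<longlonglongrightarrow> indicator {..0} \<tau> *\<^sub>R green a \<tau> (G \<tau> (u \<tau>))"
      using AE_lborel_singleton[of a]
      by eventually_elim (intro tendsto_intros tendsto_green LIMSEQ_ignore_initial_segment X(2))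
    show "AE \<tau> in lborel. norm (indicator {..0} \<tau> *\<^sub>R green (X (n + N)) \<tau> (G \<tau> (u \<tau>)))
            \<le> \<delta> / 4 * C * exp \<delta> * exp (- \<delta> * \<bar>a - \<tau>\<bar>)" for n
    proof (rule AE_I2)
      fix \<tau>
      have "\<bar>a - \<tau>\<bar> \<le> 1 + \<bar>X (n + N) - \<tau>\<bar>" using N[of "n + N"] by auto
      from mult_left_mono[OF this, of \<delta>]
      have "exp (- \<delta> * \<bar>X (n + N) - \<tau>\<bar>) \<le> exp \<delta> * exp (- \<delta> * \<bar>a - \<tau>\<bar>)"
        using delta_pos by (simp flip: exp_add add: algebra_simps)
      then have "\<delta> / 4 * C * exp (- \<delta> * \<bar>X (n + N) - \<tau>\<bar>)
            \<le> \<delta> / 4 * C * (exp \<delta> * exp (- \<delta> * \<bar>a - \<tau>\<bar>))"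
        using delta_pos C_nonneg[OF u C] by (intro mult_left_mono) auto
      then show "norm (indicator {..0} \<tau> *\<^sub>R green (X (n + N)) \<tau> (G \<tau> (u \<tau>)))
            \<le> \<delta> / 4 * C * exp \<delta> * exp (- \<delta> * \<bar>a - \<tau>\<bar>)"
        using green_bound[OF u C, of \<tau> "X (n + N)"] by simp
    qed
  qed
  then have "(\<lambda>n. LINT \<tau>:{..0}|lborel. green (X n) \<tau> (G \<tau> (u \<tau>)))
        \<longlonglongrightarrow> (LINT \<tau>:{..0}|lborel. green a \<tau> (G \<tau> (u \<tau>)))"
    by (rule LIMSEQ_offset)
  moreover have "(\<lambda>n. R (X n) 0 \<xi>) \<longlonglongrightarrow> R a 0 \<xi>" using X by (intro tendsto_R) auto
  ultimately show "(\<lambda>n. lp \<xi> u (X n)) \<longlonglongrightarrow> lp \<xi> u a"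
    unfolding lp_def by (rule tendsto_add[rotated])
qed

text \<open>The summand \<open>D / 2\<close> is \<delta> / 4 times the kernel mass 2 / \<delta>. Two
  parameters are allowed because equal ones give the contraction, different ones the Lipschitz
  dependence of the fixed point on \<xi>, and comparison with the zero function the boundedness of
  \<open>lp \<xi> u\<close>.\<close>

lemma lp_diff:
  assumes u: "continuous_on {..0} u" and C: "\<And>\<tau>. \<tau> \<le> 0 \<Longrightarrow> norm (u \<tau>) \<le> C"
    and v: "continuous_on {..0} v" and C': "\<And>\<tau>. \<tau> \<le> 0 \<Longrightarrow> norm (v \<tau>) \<le> C'"
    and t: "t \<le> 0" and D: "\<And>\<tau>. \<tau> \<le> 0 \<Longrightarrow> norm (u \<tau> - v \<tau>) \<le> D"
  shows "norm (lp \<xi> u t - lp \<eta> v t) \<le> K 0 * norm (\<xi> - \<eta>) + D / 2"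
proof -
  have D0: "0 \<le> D" using D[of 0] norm_ge_zero order_trans by blast
  have eq: "lp \<xi> u t - lp \<eta> v t =
      R t 0 (\<xi> - \<eta>) + (LINT \<tau>:{..0}|lborel. green t \<tau> (G \<tau> (u \<tau>) - G \<tau> (v \<tau>)))"
    by (simp add: lp_def green_diff blinfun.diff_right
        set_integral_diff(2)[OF green_integrable[OF u C t] green_integrable[OF v C' t]])
  have "norm (R t 0 (\<xi> - \<eta>)) \<le> K 0 * exp (- \<delta> * (0 - t)) * norm (\<xi> - \<eta>)"
    using t by (rule norm_R)
  also have "\<dots> \<le> K 0 * 1 * norm (\<xi> - \<eta>)"
    using K_pos[of 0] delta_pos t
    by (intro mult_right_mono mult_left_mono) (auto simp: mult_nonneg_nonpos)
  finally have 1: "norm (R t 0 (\<xi> - \<eta>)) \<le> K 0 * norm (\<xi> - \<eta>)" by simp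
  have int: "has_bochner_integral lborel (\<lambda>\<tau>. \<delta> / 4 * D * exp (- \<delta> * \<bar>t - \<tau>\<bar>)) (\<delta> / 4 * D * (2 / \<delta>))"
    by (intro has_bochner_integral_mult_right has_bochner_integral_exp_abs delta_pos)
  have "norm (LINT \<tau>:{..0}|lborel. green t \<tau> (G \<tau> (u \<tau>) - G \<tau> (v \<tau>)))
     \<le> (LINT \<tau>|lborel. \<delta> / 4 * D * exp (- \<delta> * \<bar>t - \<tau>\<bar>))"
    unfolding set_lebesgue_integral_def
  proof (rule Bochner_Integration.integral_norm_bound_integral)
    show "integrable lborel (\<lambda>\<tau>. indicator {..0} \<tau> *\<^sub>R green t \<tau> (G \<tau> (u \<tau>) - G \<tau> (v \<tau>)))"
      using set_integral_diff(1)[OF green_integrable[OF u C t] green_integrable[OF v C' t]]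
      by (simp add: set_integrable_def green_diff)
    show "integrable lborel (\<lambda>\<tau>. \<delta> / 4 * D * exp (- \<delta> * \<bar>t - \<tau>\<bar>))"
      using int by (rule integrable.intros)
    fix \<tau> :: real
    show "norm (indicator {..0} \<tau> *\<^sub>R green t \<tau> (G \<tau> (u \<tau>) - G \<tau> (v \<tau>)))
        \<le> \<delta> / 4 * D * exp (- \<delta> * \<bar>t - \<tau>\<bar>)"
    proof (cases "\<tau> \<le> 0")
      case True
      have "\<delta> / 4 * norm (u \<tau> - v \<tau>) * exp (- \<delta> * \<bar>t - \<tau>\<bar>) \<le> \<delta> / 4 * D * exp (- \<delta> * \<bar>t - \<tau>\<bar>)"
        using delta_pos True by (intro mult_right_mono mult_left_mono D) auto
      then show ?thesis using norm_green_G[of t \<tau> "u \<tau>" "v \<tau>"] True by simp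
    qed (use delta_pos D0 in simp)
  qed
  also have "\<dots> = D / 2"
    using int delta_pos by (simp add: has_bochner_integral_iff)
  finally show ?thesis unfolding eq by (rule norm_triangle_mono[OF 1])
qed

lemma lp_zero: "lp 0 (\<lambda>_. 0) t = 0"
  using green_diff[of t _ 0 0] by (simp add: lp_def G_zero)

lemma lp_bound:
  assumes u: "continuous_on {..0} u" and C: "\<And>\<tau>. \<tau> \<le> 0 \<Longrightarrow> norm (u \<tau>) \<le> C" and "t \<le> 0"
  shows "norm (lp \<xi> u t) \<le> K 0 * norm \<xi> + C / 2"
  using lp_diff[OF u C _ _ \<open>t \<le> 0\<close>, of "\<lambda>_. 0" 0 C \<xi> 0] C lp_zero by simp

text \<open>Integrated over \<open>\<tau>\<close>, this jump is the Duhamel term of the mild formula.\<close>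

lemma green_jump:
  assumes "s \<le> t" "\<tau> \<noteq> t"
  shows "green t \<tau> x - V t s (green s \<tau> x) = (if \<tau> \<in> {s..t} then V t \<tau> x else 0)"
proof -
  consider "\<tau> < s" | "s \<le> \<tau>" "\<tau> < t" | "t < \<tau>" using assms by linarith
  then show ?thesis
  proof cases
    case 1
    then show ?thesis using assms by (simp add: green_def V_comp)
  next
    case 2
    have "V t s (R s \<tau> x) = V t \<tau> (V \<tau> s (R s \<tau> x))" using 2 by (simp add: V_comp)
    also have "\<dots> = V t \<tau> (Q \<tau> x)" using 2 by (simp add: VR)
    finally have "green t \<tau> x - V t s (green s \<tau> x) = V t \<tau> (P \<tau> x + Q \<tau> x)"
      using 2 by (simp add: green_def blinfun.minus_right blinfun.add_right)
    then show ?thesis using 2 by (simp add: PQ)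
  next
    case 3
    then show ?thesis using assms VR_comp[of s t \<tau> x] by (simp add: green_def blinfun.minus_right)
  qed
qed

text \<open>Here \<open>u\<close> need not be a fixed point: \<open>lp \<xi> u\<close> solves the
  linear equation with the prescribed forcing \<open>G \<tau> (u \<tau>)\<close>. Transporting its
  value at \<open>s\<close> to \<open>t\<close> cancels the term with \<xi> by
  \<open>VR_comp\<close>, and in the integral only the jump of the kernel over \<open>{s..t}\<close>
  survives.\<close>

lemma lp_mild:
  assumes u: "continuous_on {..0} u" and C: "\<And>\<tau>. \<tau> \<le> 0 \<Longrightarrow> norm (u \<tau>) \<le> C"
    and st: "s \<le> t" "t \<le> 0"
    and meas: "(\<lambda>\<tau>. indicator {s..t} \<tau> *\<^sub>R V t \<tau> (G \<tau> (u \<tau>))) \<in> borel_measurable borel"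
  shows "set_integrable lborel {s..t} (\<lambda>\<tau>. V t \<tau> (G \<tau> (u \<tau>)))"
    and "lp \<xi> u t = V t s (lp \<xi> u s) + (LINT \<tau>:{s..t}|lborel. V t \<tau> (G \<tau> (u \<tau>)))"
proof -
  let ?g = "\<lambda>t \<tau>. indicator {..0} \<tau> *\<^sub>R green t \<tau> (G \<tau> (u \<tau>))"
  let ?f = "\<lambda>\<tau>. indicator {s..t} \<tau> *\<^sub>R V t \<tau> (G \<tau> (u \<tau>))"
  have gt: "integrable lborel (?g t)" and gs: "integrable lborel (?g s)"
    using green_integrable[OF u C] st by (auto simp: set_integrable_def)
  have Vgs: "integrable lborel (\<lambda>\<tau>. V t s (?g s \<tau>))"
    by (intro integrable_bounded_linear[OF blinfun.bounded_linear_right] gs)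
  have ae: "AE \<tau> in lborel. ?g t \<tau> - V t s (?g s \<tau>) = ?f \<tau>"
    using AE_lborel_singleton[of t]
  proof eventually_elim
    case (elim \<tau>)
    show ?case using green_jump[OF st(1) elim, of "G \<tau> (u \<tau>)"] st by (auto simp: indicator_def)
  qed
  have dif: "integrable lborel (\<lambda>\<tau>. ?g t \<tau> - V t s (?g s \<tau>))"
    using gt Vgs by (rule Bochner_Integration.integrable_diff)
  show "set_integrable lborel {s..t} (\<lambda>\<tau>. V t \<tau> (G \<tau> (u \<tau>)))"
    unfolding set_integrable_def using dif _ ae by (rule integrable_cong_AE_imp) (simp add: meas)
  have "(LINT \<tau>|lborel. ?f \<tau>) = (LINT \<tau>|lborel. ?g t \<tau> - V t s (?g s \<tau>))"
  proof (rule integral_cong_AE)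
    show "AE \<tau> in lborel. ?f \<tau> = ?g t \<tau> - V t s (?g s \<tau>)"
      using ae by eventually_elim (rule sym)
    show "?f \<in> borel_measurable lborel" using meas by simp
  qed (rule borel_measurable_integrable[OF dif])
  also have "\<dots> = (LINT \<tau>|lborel. ?g t \<tau>) - V t s (LINT \<tau>|lborel. ?g s \<tau>)"
    by (simp add: Bochner_Integration.integral_diff[OF gt Vgs]
        integral_bounded_linear[OF blinfun.bounded_linear_right gs])
  finally show "lp \<xi> u t = V t s (lp \<xi> u s) + (LINT \<tau>:{s..t}|lborel. V t \<tau> (G \<tau> (u \<tau>)))"
    using VR_comp[OF st, of \<xi>] by (simp add: lp_def set_lebesgue_integral_def blinfun.add_right)
qed

text \<open>At time 0 every source \<tau> < 0 contributes through the stable half of the kernel,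
  which \<open>Q 0\<close> annihilates. Hence \<xi> can be recovered from the value of a fixed point
  at time 0, and the set of these values is a graph.\<close>

lemma Q_lp_0:
  assumes u: "continuous_on {..0} u" and C: "\<And>\<tau>. \<tau> \<le> 0 \<Longrightarrow> norm (u \<tau>) \<le> C"
  shows "Q 0 (lp \<xi> u 0) = Q 0 \<xi>"
proof -
  let ?g = "\<lambda>\<tau>. indicator {..0} \<tau> *\<^sub>R green 0 \<tau> (G \<tau> (u \<tau>))"
  have Q0: "Q 0 (?g \<tau>) = 0" if "\<tau> \<noteq> 0" for \<tau>
  proof -
    have "Q \<tau> (P \<tau> x) = 0" for x
    proof -
      have "Q \<tau> (P \<tau> x) + Q \<tau> (Q \<tau> x) = Q \<tau> x" by (simp add: PQ flip: blinfun.add_right)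
      then show ?thesis by (simp add: Q_idem)
    qed
    then show ?thesis using that by (auto simp: indicator_def green_def QV)
  qed
  have "Q 0 (LINT \<tau>|lborel. ?g \<tau>) = (LINT \<tau>|lborel. Q 0 (?g \<tau>))"
    using green_integrable[OF u C, of 0]
    by (simp add: integral_bounded_linear[OF blinfun.bounded_linear_right] set_integrable_def)
  also have "\<dots> = 0"
    using AE_lborel_singleton[of 0] Q0 by (intro integral_eq_zero_AE) (auto elim: eventually_mono)
  finally show ?thesis
    by (simp add: lp_def set_lebesgue_integral_def blinfun.add_right R_id Q_idem)
qed

text \<open>The unstable part at \<open>t\<close> is pulled back from time 0, where it vanishes. The
  stable part is pushed forward from an arbitrarily early \<open>s\<close>, where \<open>d\<close>
  is still bounded by \<open>C\<close>, and \<open>K_sub\<close> provides an \<open>s\<close> that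
  makes it as small as desired.\<close>

lemma bounded_orbit_zero:
  assumes d: "\<And>s t. s \<le> t \<Longrightarrow> t \<le> 0 \<Longrightarrow> d t = V t s (d s)"
    and C: "\<And>t. t \<le> 0 \<Longrightarrow> norm (d t) \<le> C" and Q0: "Q 0 (d 0) = 0" and t: "t \<le> 0"
  shows "d t = 0"
proof -
  have "Q t (d t) = R t 0 (Q 0 (d 0))"
    using t d[of t 0] by (simp add: RQ RV)
  then have Qd: "Q t (d t) = 0" using Q0 by simp
  have small: "norm (P t (d t)) \<le> e" if e: "0 < e" for e
  proof -
    have C0: "0 \<le> C" using C[of 0] norm_ge_zero order_trans by blast
    \<comment> \<open>Chosen so that the factor \<open>exp (- \<delta> * t)\<close> and the bound on
      \<open>d s\<close> cancel; \<open>C + 1\<close> replaces \<open>C\<close> to avoid division by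
      0.\<close>
    define e' where "e' = e * exp (\<delta> * t) / (C + 1)"
    have "0 < e'" using e C0 by (simp add: e'_def)
    from K_sub[OF this, of t] obtain s where s: "s \<le> t" "K s * exp (\<delta> * s) < e'" by blast
    have "norm (P t (d t)) = norm (V t s (P s (d s)))" using s t by (simp add: d[of s t] PV)
    also have "\<dots> \<le> K s * exp (- \<delta> * (t - s)) * norm (d s)" by (rule norm_VP[OF s(1)])
    also have "\<dots> \<le> K s * exp (- \<delta> * (t - s)) * (C + 1)"
      using K_pos[of s] C[of s] s t by (intro mult_left_mono) auto
    also have "exp (- \<delta> * (t - s)) = exp (\<delta> * s) * exp (- \<delta> * t)"
      by (simp add: right_diff_distrib flip: exp_add)
    also have "K s * (exp (\<delta> * s) * exp (- \<delta> * t)) * (C + 1)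
        = (K s * exp (\<delta> * s)) * (exp (- \<delta> * t) * (C + 1))"
      by (simp only: mult.assoc)
    also have "\<dots> \<le> e' * (exp (- \<delta> * t) * (C + 1))"
      using s(2) C0 by (intro mult_right_mono) auto
    also have "\<dots> = e" using C0 by (simp add: e'_def exp_minus)
    finally show ?thesis .
  qed
  have "norm (P t (d t)) \<le> 0" by (rule field_le_epsilon) (simp add: small)
  then show ?thesis using PQ[of t "d t"] Qd by simp
qed

section \<open>Bounded mild solutions as fixed points\<close>

definition mild :: "(real \<Rightarrow> 'h) \<Rightarrow> bool" where
  "mild u \<longleftrightarrow> (\<forall>s t. s \<le> t \<longrightarrow> t \<le> 0 \<longrightarrow>
     set_integrable lborel {s..t} (\<lambda>\<tau>. V t \<tau> (G \<tau> (u \<tau>))) \<and>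
     u t = V t s (u s) + (LINT \<tau>:{s..t}|lborel. V t \<tau> (G \<tau> (u \<tau>))))"

text \<open>By \<open>lp_mild\<close>, \<open>u\<close> and its image obey the mild formula with the
  same forcing, so their difference is an orbit of the linear equation. It is bounded, and the
  choice \<xi> = \<open>Q 0 (u 0)\<close> removes its unstable part at time 0.\<close>

lemma mild_imp_lp:
  assumes u: "continuous_on {..0} u" and C: "\<And>\<tau>. \<tau> \<le> 0 \<Longrightarrow> norm (u \<tau>) \<le> C"
    and m: "mild u" and t: "t \<le> 0"
  shows "u t = lp (Q 0 (u 0)) u t"
proof -
  let ?w = "lp (Q 0 (u 0)) u"
  have eq: "u t - ?w t = V t s (u s - ?w s)" if "s \<le> t" "t \<le> 0" for s t
  proof -
    have i: "set_integrable lborel {s..t} (\<lambda>\<tau>. V t \<tau> (G \<tau> (u \<tau>)))"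
      and e: "u t = V t s (u s) + (LINT \<tau>:{s..t}|lborel. V t \<tau> (G \<tau> (u \<tau>)))"
      using m that unfolding mild_def by blast+
    show ?thesis
      using lp_mild(2)[OF u C that, of "Q 0 (u 0)"] i e
      by (simp add: blinfun.diff_right set_integrable_def borel_measurable_integrable)
  qed
  have "u t - ?w t = 0"
  proof (rule bounded_orbit_zero[where d = "\<lambda>t. u t - ?w t", OF eq _ _ t])
    show "norm (u t - ?w t) \<le> C + (K 0 * norm (Q 0 (u 0)) + C / 2)" if "t \<le> 0" for t
      using C[OF that] lp_bound[OF u C that, of "Q 0 (u 0)"] norm_triangle_ineq4[of "u t" "?w t"]
      by linarith
    show "Q 0 (u 0 - ?w 0) = 0"
      by (simp add: blinfun.diff_right Q_lp_0[OF u C] Q_idem)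
  qed
  then show ?thesis by simp
qed

lemma meas_VG:
  assumes u: "continuous_on {..0} u" and t: "t \<le> 0"
  shows "(\<lambda>\<tau>. indicator {s..t} \<tau> *\<^sub>R V t \<tau> (G \<tau> (u \<tau>))) \<in> borel_measurable borel"
proof -
  define v where "v \<tau> = u (min \<tau> 0)" for \<tau>
  have "continuous_on UNIV v"
    unfolding v_def by (intro continuous_on_compose2[OF u] continuous_intros) auto
  then have v: "v \<in> borel_measurable borel" by (rule borel_measurable_continuous_onI)
  note [measurable] = meas_VPG[OF v, of t] meas_VQG[OF v, of t]
  have "V t \<tau> (P \<tau> x) + V t \<tau> (Q \<tau> x) = V t \<tau> x" for \<tau> x
    by (simp add: PQ flip: blinfun.add_right)
  then have "(\<lambda>\<tau>. indicator {s..t} \<tau> *\<^sub>R V t \<tau> (G \<tau> (u \<tau>))) =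
     (\<lambda>\<tau>. indicator {s..t} \<tau> *\<^sub>R (indicator {..t} \<tau> *\<^sub>R V t \<tau> (P \<tau> (G \<tau> (v \<tau>)))
        + indicator {..t} \<tau> *\<^sub>R V t \<tau> (Q \<tau> (G \<tau> (v \<tau>)))))"
    using t by (auto simp: fun_eq_iff indicator_def v_def min_def)
  also have "\<dots> \<in> borel_measurable borel" by measurable
  finally show ?thesis .
qed

lemma lp_imp_mild:
  assumes u: "continuous_on {..0} u" and C: "\<And>\<tau>. \<tau> \<le> 0 \<Longrightarrow> norm (u \<tau>) \<le> C"
    and lpu: "\<And>t. t \<le> 0 \<Longrightarrow> u t = lp \<xi> u t"
  shows "mild u"
  unfolding mild_def
proof (intro allI impI)
  fix s t :: real assume st: "s \<le> t" "t \<le> 0"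
  note lp_mild(1)[OF u C st meas_VG[OF u st(2)]] lp_mild(2)[OF u C st meas_VG[OF u st(2)], of \<xi>]
  then show "set_integrable lborel {s..t} (\<lambda>\<tau>. V t \<tau> (G \<tau> (u \<tau>))) \<and>
     u t = V t s (u s) + (LINT \<tau>:{s..t}|lborel. V t \<tau> (G \<tau> (u \<tau>)))"
    using lpu[of s] lpu[of t] st by auto
qed

text \<open>The complete metric space is the type of bounded continuous functions on the whole line.
  Functions on \<open>{..0}\<close> enter it frozen at positive times, which is the purpose of
  \<open>min t 0\<close>; \<open>lp\<close> reads its argument on \<open>{..0}\<close> only.\<close>

lemma ex1_lp_fixpoint:
  "\<exists>!f :: real \<Rightarrow>\<^sub>C 'h. \<forall>t. apply_bcontfun f t = lp \<xi> f (min t 0)"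
proof -
  define T where "T f = Bcontfun (\<lambda>t. lp \<xi> (apply_bcontfun f) (min t 0))" for f :: "real \<Rightarrow>\<^sub>C 'h"
  have bd: "norm (apply_bcontfun f \<tau>) \<le> norm f" for f :: "real \<Rightarrow>\<^sub>C 'h" and \<tau>
    by (rule norm_bounded)
  have T: "apply_bcontfun (T f) t = lp \<xi> f (min t 0)" for f t
  proof -
    have "(\<lambda>t. lp \<xi> (apply_bcontfun f) (min t 0)) \<in> bcontfun"
    proof (rule bcontfun_normI)
      show "continuous_on UNIV (\<lambda>t. lp \<xi> (apply_bcontfun f) (min t 0))"
        by (rule continuous_on_compose2[OF lp_cont[OF _ bd]]) (auto intro!: continuous_intros)
      show "norm (lp \<xi> (apply_bcontfun f) (min t 0)) \<le> K 0 * norm \<xi> + norm f / 2" for t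
        by (rule lp_bound[OF _ bd]) auto
    qed
    then show ?thesis by (simp add: T_def Bcontfun_inverse)
  qed
  have "\<exists>!f. T f = f"
  proof (rule banach_fix_type[of "1/2"])
    show "\<forall>f g. dist (T f) (T g) \<le> 1/2 * dist f g"
    proof (intro allI dist_bound)
      fix f g :: "real \<Rightarrow>\<^sub>C 'h" and t
      have "norm (lp \<xi> f (min t 0) - lp \<xi> g (min t 0)) \<le> K 0 * norm (\<xi> - \<xi>) + dist f g / 2"
        by (rule lp_diff[OF _ bd _ bd]) (auto simp: dist_bounded simp flip: dist_norm)
      then show "dist (T f t) (T g t) \<le> 1/2 * dist f g" by (simp add: T dist_norm)
    qed
  qed auto
  moreover have "T f = f \<longleftrightarrow> (\<forall>t. apply_bcontfun f t = lp \<xi> f (min t 0))" for f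
    by (metis T bcontfun_eqI)
  ultimately show ?thesis by simp
qed

theorem bounded_mild_graph:
  obtains h where "\<And>p. p \<in> range (Q 0) \<Longrightarrow> h p \<in> range (P 0)"
    "\<exists>L. L-lipschitz_on (range (Q 0)) h" "h 0 = 0"
    "{u 0 | u. mild u \<and> continuous_on {..0} u \<and> bounded (u ` {..0})} = {p + h p | p. p \<in> range (Q 0)}"
proof -
  obtain S :: "'h \<Rightarrow> real \<Rightarrow>\<^sub>C 'h" where S: "\<And>\<xi> t. apply_bcontfun (S \<xi>) t = lp \<xi> (S \<xi>) (min t 0)"
    and S1: "\<And>\<xi> f. (\<And>t. apply_bcontfun f t = lp \<xi> f (min t 0)) \<Longrightarrow> f = S \<xi>"
    using ex1_lp_fixpoint by metis
  have bd: "norm (apply_bcontfun f \<tau>) \<le> norm f" for f :: "real \<Rightarrow>\<^sub>C 'h" and \<tau>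
    by (rule norm_bounded)
  \<comment> \<open>The stable component, at time 0, of the fixed point whose unstable component
    there is \<open>p\<close>.\<close>
  define h where "h p = P 0 (S p 0)" for p
  have QS: "Q 0 (S p 0) = p" if "p \<in> range (Q 0)" for p
  proof -
    have "Q 0 (lp p (S p) 0) = Q 0 p" by (rule Q_lp_0[OF _ bd]) simp
    then show ?thesis using that S[of p 0] by (auto simp: Q_idem)
  qed
  have graph: "S p 0 = p + h p" if "p \<in> range (Q 0)" for p
    using PQ[of 0 "S p 0"] QS[OF that] by (simp add: h_def add.commute)
  have dS: "dist (S p) (S q) \<le> 2 * K 0 * norm (p - q)" for p q
  proof -
    \<comment> \<open>Both sides of \<open>lp_diff\<close> concern fixed points here, so half of the
      distance reappears on the right and is absorbed; this doubles \<open>K 0\<close>.\<close>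
    have "dist (S p) (S q) \<le> K 0 * norm (p - q) + dist (S p) (S q) / 2"
    proof (rule dist_bound)
      fix t
      have "norm (lp p (S p) (min t 0) - lp q (S q) (min t 0))
         \<le> K 0 * norm (p - q) + dist (S p) (S q) / 2"
        by (rule lp_diff[OF _ bd _ bd]) (auto simp: dist_bounded simp flip: dist_norm)
      then show "dist (S p t) (S q t) \<le> K 0 * norm (p - q) + dist (S p) (S q) / 2"
        using S[of p t] S[of q t] by (simp add: dist_norm)
    qed
    then show ?thesis by simp
  qed
  show thesis
  proof
    show "h p \<in> range (P 0)" for p by (simp add: h_def)
    have "(norm (P 0) * (2 * K 0))-lipschitz_on (range (Q 0)) h"
    proof (rule lipschitz_onI)
      fix p q
      have "dist (h p) (h q) \<le> norm (P 0) * dist (S p 0) (S q 0)"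
        unfolding h_def dist_norm by (metis blinfun.diff_right norm_blinfun)
      also have "\<dots> \<le> norm (P 0) * (2 * K 0 * norm (p - q))"
        by (intro mult_left_mono order_trans[OF dist_bounded dS]) auto
      finally show "dist (h p) (h q) \<le> norm (P 0) * (2 * K 0) * dist p q" by (simp add: dist_norm)
    qed (use K_pos[of 0] in simp)
    then show "\<exists>L. L-lipschitz_on (range (Q 0)) h" ..
    \<comment> \<open>The zero function is a fixed point for \<xi> = 0, hence the only one.\<close>
    have "0 = S 0" by (rule S1) (simp add: lp_zero zero_bcontfun.rep_eq)
    then have "apply_bcontfun (S 0) 0 = 0" by (metis zero_bcontfun.rep_eq)
    then show "h 0 = 0" by (simp add: h_def)
    show "{u 0 | u. mild u \<and> continuous_on {..0} u \<and> bounded (u ` {..0})}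
        = {p + h p | p. p \<in> range (Q 0)}"
    proof (intro equalityI subsetI)
      fix x assume "x \<in> {u 0 | u. mild u \<and> continuous_on {..0} u \<and> bounded (u ` {..0})}"
      then obtain u where u: "x = u 0" "mild u" "continuous_on {..0} u" "bounded (u ` {..0})" by auto
      then obtain C where C: "\<And>\<tau>. \<tau> \<le> 0 \<Longrightarrow> norm (u \<tau>) \<le> C" by (auto simp: bounded_iff)
      define f where "f = Bcontfun (\<lambda>t. u (min t 0))"
      have f: "apply_bcontfun f t = u (min t 0)" for t
      proof -
        have "(\<lambda>t. u (min t 0)) \<in> bcontfun"
          by (rule bcontfun_normI[OF continuous_on_compose2[OF u(3)]])
             (auto intro!: continuous_intros C)
        then show ?thesis by (simp add: f_def Bcontfun_inverse)
      qed
      have lpf: "lp \<xi> f = lp \<xi> u" for \<xi>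
        unfolding lp_def fun_eq_iff by (auto intro!: set_lebesgue_integral_cong simp: f min_def)
      have "f = S (Q 0 (u 0))"
        by (rule S1) (simp add: lpf f mild_imp_lp[OF u(3) C u(2), symmetric])
      then have "x = S (Q 0 (u 0)) 0" using f[of 0] u(1) by simp
      then show "x \<in> {p + h p | p. p \<in> range (Q 0)}" using graph by auto
    next
      fix x assume "x \<in> {p + h p | p. p \<in> range (Q 0)}"
      then obtain p where p: "p \<in> range (Q 0)" "x = p + h p" by auto
      have "mild (S p)"
      proof (rule lp_imp_mild[OF _ bd])
        show "S p t = lp p (S p) t" if "t \<le> 0" for t
          using S[of p t] that by (simp only: min_absorb1)
      qed simp
      moreover have "bounded (S p ` {..0})" using bd by (auto simp: bounded_iff)
      ultimately show "x \<in> {u 0 | u. mild u \<and> continuous_on {..0} u \<and> bounded (u ` {..0})}"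
        using graph[OF p(1)] p(2) by (auto intro!: exI[of _ "apply_bcontfun (S p)"])
    qed
  qed
qed

end

section \<open>Measurability and bounded inverses\<close>

text \<open>The nonlinearity and the projections are measurable in \<omega> for each fixed vector,
  but have to be evaluated at a vector that varies with time. For a simple \<open>z\<close> this is
  a patching of finitely many cases, and continuity in the vector passes to the limit.\<close>

lemma borel_measurable_Caratheodory:
  fixes f :: "'a \<Rightarrow> 'b::{metric_space,second_countable_topology} \<Rightarrow> 'c::metric_space"
  assumes f: "\<And>x. (\<lambda>\<omega>. f \<omega> x) \<in> borel_measurable N"
    and cont: "\<And>\<omega>. \<omega> \<in> space N \<Longrightarrow> continuous_on UNIV (f \<omega>)"
    and z: "z \<in> borel_measurable N"
  shows "(\<lambda>\<omega>. f \<omega> (z \<omega>)) \<in> borel_measurable N"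
proof -
  obtain S where S: "\<And>i. simple_function N (S i)" "\<And>\<omega>. \<omega> \<in> space N \<Longrightarrow> (\<lambda>i. S i \<omega>) \<longlonglongrightarrow> z \<omega>"
    using borel_measurable_implies_sequence_metric[OF z, of undefined] by blast
  show ?thesis
  proof (rule borel_measurable_LIMSEQ_metric)
    fix i
    have fin: "finite (S i ` space N)" using S(1)[of i] by (simp add: simple_function_def)
    have "S i \<in> measurable N (count_space (S i ` space N))"
      using S(1)[of i] by (subst measurable_count_space_eq2[OF fin]) (auto simp: simple_function_def)
    then show "(\<lambda>\<omega>. f \<omega> (S i \<omega>)) \<in> borel_measurable N"
      by (rule measurable_compose_countable'[where f = "\<lambda>x \<omega>. f \<omega> x", OF f])
        (rule countable_finite[OF fin])
  next
    fix \<omega> assume "\<omega> \<in> space N"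
    then show "(\<lambda>i. f \<omega> (S i \<omega>)) \<longlonglongrightarrow> f \<omega> (z \<omega>)"
      using S(2) by (intro continuous_on_tendsto_compose[OF cont]) auto
  qed
qed

lemma linear_continuous_imp_bounded_linear:
  fixes f :: "'a::real_normed_vector \<Rightarrow> 'b::real_normed_vector"
  assumes "linear f" "continuous_on UNIV f"
  shows "bounded_linear f"
proof -
  interpret linear f by fact
  obtain d where d: "0 < d" "\<And>x. norm x < d \<Longrightarrow> norm (f x) < 1"
    using assms(2)[unfolded continuous_on_iff, rule_format, of 0 1] by (auto simp: zero)
  have "norm (f x) \<le> norm x * (2 / d)" for x
  proof (cases "x = 0")
    case False
    let ?c = "d / (2 * norm x)"
    have "norm (f (?c *\<^sub>R x)) < 1" using d(1) False by (intro d(2)) auto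
    then show ?thesis using d(1) False by (simp add: scale field_simps)
  qed (simp add: zero)
  then show ?thesis
    by (rule bounded_linear_intro[OF add scale])
qed

text \<open>This makes the backward motion a bounded operator on the whole space, so that
  \<open>Blinfun\<close> and \<open>onorm\<close> can be applied to it. Linearity of the inverse
  comes from injectivity of \<open>W\<close> on \<open>E\<close>, continuity from the
  homeomorphism.\<close>

lemma bounded_linear_inv_into:
  fixes W Q :: "'h::real_normed_vector \<Rightarrow>\<^sub>L 'h"
  assumes E: "subspace E" and E': "subspace E'" and hom: "homeomorphism E E' W (inv_into E W)"
    and Q: "\<And>x. Q x \<in> E'"
  shows "bounded_linear (\<lambda>x. inv_into E W (Q x))"
proof (rule linear_continuous_imp_bounded_linear)
  let ?i = "inv_into E W"
  have i: "?i y \<in> E" "W (?i y) = y" if "y \<in> E'" for y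
    using hom that by (auto simp: homeomorphism_def)
  have iW: "?i (W x) = x" if "x \<in> E" for x
    using hom that by (auto simp: homeomorphism_def)
  show "linear (\<lambda>x. ?i (Q x))"
  proof (rule linearI)
    fix x y
    have "?i (Q (x + y)) = ?i (W (?i (Q x) + ?i (Q y)))"
      by (simp add: blinfun.add_right i Q)
    also have "\<dots> = ?i (Q x) + ?i (Q y)" by (intro iW subspace_add E i Q)
    finally show "?i (Q (x + y)) = ?i (Q x) + ?i (Q y)" .
  next
    fix c x
    have "?i (Q (c *\<^sub>R x)) = ?i (W (c *\<^sub>R ?i (Q x)))"
      by (simp add: blinfun.scaleR_right i Q)
    also have "\<dots> = c *\<^sub>R ?i (Q x)" by (intro iW subspace_scale E i Q)
    finally show "?i (Q (c *\<^sub>R x)) = c *\<^sub>R ?i (Q x)" .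
  qed
  show "continuous_on UNIV (\<lambda>x. ?i (Q x))"
    by (rule continuous_on_compose2[of E' ?i]) (use hom Q in \<open>auto simp: homeomorphism_def intro!: continuous_intros\<close>)
qed

section \<open>Recurrence in backward time\<close>

context ergodic_mds
begin

lemma flow_space: "\<omega> \<in> space M \<Longrightarrow> \<theta> t \<omega> \<in> space M"
  using measurable_space[OF measurable_flow, of "(t, \<omega>)"] by (simp add: space_pair_measure)

lemma measurable_orbit: "\<omega> \<in> space M \<Longrightarrow> (\<lambda>t. \<theta> t \<omega>) \<in> borel \<rightarrow>\<^sub>M M"
  using measurable_compose[OF _ measurable_flow, of "\<lambda>t. (t, \<omega>)" borel] by simp

lemma measurable_flow_map: "\<theta> t \<in> M \<rightarrow>\<^sub>M M"
  using measurable_compose[OF _ measurable_flow, of "\<lambda>\<omega>. (t, \<omega>)" M] by simp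

lemma flow_invariant_mem: "flow_invariant M \<theta> D \<Longrightarrow> \<omega> \<in> space M \<Longrightarrow> \<theta> t \<omega> \<in> D \<longleftrightarrow> \<omega> \<in> D"
  unfolding flow_invariant_def by blast

text \<open>Valued in \<open>ennreal\<close>, so that divergence is the value infinity. It is
  applied to 1 / K.\<close>

definition past :: "('w \<Rightarrow> ennreal) \<Rightarrow> real \<Rightarrow> 'w \<Rightarrow> ennreal" where
  "past f s \<omega> = (\<integral>\<^sup>+ t. f (\<theta> t \<omega>) * indicator {..s} t \<partial>lborel)"

context
  fixes f :: "'w \<Rightarrow> ennreal"
  assumes f [measurable]: "f \<in> borel_measurable M"
begin

lemma measurable_past [measurable]: "past f s \<in> borel_measurable M"
proof -
  have "(\<lambda>(\<omega>, t). \<theta> t \<omega>) \<in> M \<Otimes>\<^sub>M lborel \<rightarrow>\<^sub>M M"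
    using measurable_flow by (subst measurable_pair_swap_iff) (simp add: case_prod_beta' cong: measurable_cong_sets)
  note [measurable] = this[unfolded case_prod_beta']
  show ?thesis unfolding past_def by measurable
qed

lemma past_flow:
  assumes "\<omega> \<in> space M"
  shows "past f s (\<theta> r \<omega>) = past f (s + r) \<omega>"
proof -
  note [measurable] = measurable_orbit[OF assms]
  have "past f (s + r) \<omega> = (\<integral>\<^sup>+ t. f (\<theta> (r + 1 * t) \<omega>) * indicator {..s + r} (r + 1 * t) \<partial>lborel)"
    unfolding past_def by (subst nn_integral_real_affine[of _ 1 r]) auto
  also have "\<dots> = past f s (\<theta> r \<omega>)"
    unfolding past_def by (intro nn_integral_cong) (auto simp: flow_add[OF assms, symmetric] indicator_def add.commute)
  finally show ?thesis ..
qed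

text \<open>As \<open>f\<close> is at most 1, moving the endpoint changes the integral by at most
  \<open>b - a\<close>. Together with \<open>past_flow\<close> this makes divergence a property of
  the whole orbit.\<close>

lemma past_infinite_iff:
  assumes le1: "\<And>\<omega>. f \<omega> \<le> 1" and \<omega>: "\<omega> \<in> space M" and "a \<le> b"
  shows "past f b \<omega> = \<infinity> \<longleftrightarrow> past f a \<omega> = \<infinity>"
proof -
  note [measurable] = measurable_orbit[OF \<omega>]
  have le: "past f a \<omega> \<le> past f b \<omega>"
    unfolding past_def using \<open>a \<le> b\<close> by (intro nn_integral_mono) (auto simp: indicator_def)
  have "past f b \<omega> \<le> (\<integral>\<^sup>+ t. f (\<theta> t \<omega>) * indicator {..a} t + indicator {a..b} t \<partial>lborel)"
    unfolding past_def using le1 by (intro nn_integral_mono) (auto simp: indicator_def)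
  also have "\<dots> = past f a \<omega> + ennreal (b - a)"
    unfolding past_def using \<open>a \<le> b\<close> by (subst nn_integral_add) auto
  finally have "past f b \<omega> \<le> past f a \<omega> + ennreal (b - a)" .
  then show ?thesis using le by (auto simp: top_unique)
qed

text \<open>On the invariant set where \<open>past f 0\<close> is finite, the tails \<open>past f (- n)\<close> tend to zero; but they
  all have the same law, so that they vanish, which contradicts the positivity of \<open>f\<close>.\<close>

lemma full_invariant_past_infinite:
  assumes D: "full_invariant M \<theta> D" and pos: "\<And>\<omega>. \<omega> \<in> D \<Longrightarrow> 0 < f \<omega>" and le1: "\<And>\<omega>. f \<omega> \<le> 1"
  shows "full_invariant M \<theta> {\<omega> \<in> D. past f 0 \<omega> = \<infinity>}"
proof -
  have Ds [measurable]: "D \<in> sets M" and Di: "flow_invariant M \<theta> D" and D1: "prob D = 1"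
    using D by (auto simp: full_invariant_def)
  have Dsp: "D \<subseteq> space M" using Ds by (rule sets.sets_into_space)
  have inv: "past f 0 (\<theta> t \<omega>) = \<infinity> \<longleftrightarrow> past f 0 \<omega> = \<infinity>" if "\<omega> \<in> space M" for t \<omega>
    using past_infinite_iff[OF le1 that, of 0 t] past_infinite_iff[OF le1 that, of t 0] past_flow[OF that, of 0 t]
    by (cases "0 \<le> t") auto
  define B where "B = {\<omega> \<in> space M. \<omega> \<in> D \<and> past f 0 \<omega> \<noteq> \<infinity>}"
  have B [measurable]: "B \<in> sets M" unfolding B_def by measurable
  \<comment> \<open>Truncation at 1 gives a dominating constant, integrable for a probability
    measure. The set \<open>B\<close> is invariant, so \<theta> moves the endpoint of the integral
    without changing the indicator.\<close>
  define g where "g \<omega> = min 1 (past f 0 \<omega>) * indicator B \<omega>" for \<omega>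
  have [measurable]: "g \<in> borel_measurable M" unfolding g_def by measurable
  have gflow: "g (\<theta> s \<omega>) = min 1 (past f s \<omega>) * indicator B \<omega>" if "\<omega> \<in> space M" for s \<omega>
    using that inv[OF that, of s] flow_invariant_mem[OF Di that, of s] flow_space[OF that]
    by (auto simp: g_def B_def past_flow indicator_def)
  have "(\<lambda>n. \<integral>\<^sup>+ \<omega>. g (\<theta> (- real n) \<omega>) \<partial>M) \<longlonglongrightarrow> (\<integral>\<^sup>+ \<omega>. 0 \<partial>M)"
  proof (rule nn_integral_dominated_convergence[where w = "\<lambda>_. 1"])
    show "(\<lambda>\<omega>. g (\<theta> (- real n) \<omega>)) \<in> borel_measurable M" for n
      by (rule measurable_compose[OF measurable_flow_map]) simp
    show "AE \<omega> in M. g (\<theta> (- real n) \<omega>) \<le> 1" for n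
      by (auto simp: g_def indicator_def)
    show "AE \<omega> in M. (\<lambda>n. g (\<theta> (- real n) \<omega>)) \<longlonglongrightarrow> 0"
    proof (rule AE_I2)
      fix \<omega> assume \<omega>: "\<omega> \<in> space M"
      note [measurable] = measurable_orbit[OF \<omega>]
      show "(\<lambda>n. g (\<theta> (- real n) \<omega>)) \<longlonglongrightarrow> 0"
      proof (cases "\<omega> \<in> B")
        case True
        have "(\<lambda>n. past f (- real n) \<omega>) \<longlonglongrightarrow> nn_integral (lborel :: real measure) (\<lambda>_. 0)"
          unfolding past_def
        proof (rule nn_integral_dominated_convergence[where w = "\<lambda>t. f (\<theta> t \<omega>) * indicator {..0} t"])
          show "(\<integral>\<^sup>+ t. f (\<theta> t \<omega>) * indicator {..0} t \<partial>lborel) < \<infinity>"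
            using True by (auto simp: B_def past_def top.not_eq_extremum)
          show "AE t in lborel. (\<lambda>n. f (\<theta> t \<omega>) * indicator {..- real n} t) \<longlonglongrightarrow> 0"
          proof (rule AE_I2)
            fix t
            obtain N where N: "- t < real N" using reals_Archimedean2 by blast
            have "\<forall>\<^sub>F n in sequentially. f (\<theta> t \<omega>) * indicator {..- real n} t = 0"
              using eventually_ge_at_top[of N] by eventually_elim (use N in \<open>auto simp: indicator_def\<close>)
            then show "(\<lambda>n. f (\<theta> t \<omega>) * indicator {..- real n} t) \<longlonglongrightarrow> 0"
              by (rule tendsto_eventually)
          qed
        qed (auto simp: indicator_def)
        then have "(\<lambda>n. min 1 (past f (- real n) \<omega>)) \<longlonglongrightarrow> min 1 0"
          by (intro tendsto_min tendsto_const) simp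
        then show ?thesis using True by (simp add: gflow[OF \<omega>])
      qed (simp add: gflow[OF \<omega>])
    qed
  qed (auto simp: emeasure_space_1)
  moreover have "(\<integral>\<^sup>+ \<omega>. g (\<theta> s \<omega>) \<partial>M) = (\<integral>\<^sup>+ \<omega>. g \<omega> \<partial>M)" for s
    using nn_integral_distr[OF measurable_flow_map[of s], of g] by (simp add: measure_invariant)
  ultimately have "(\<integral>\<^sup>+ \<omega>. g \<omega> \<partial>M) = 0"
    by (simp add: LIMSEQ_const_iff)
  then have g0: "AE \<omega> in M. g \<omega> = 0" by (simp add: nn_integral_0_iff_AE)
  have nz: "past f 0 \<omega> \<noteq> 0" if "\<omega> \<in> D" for \<omega>
  proof
    assume 0: "past f 0 \<omega> = 0"
    have \<omega>: "\<omega> \<in> space M" using that Dsp by auto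
    note [measurable] = measurable_orbit[OF \<omega>]
    have "AE t in lborel. f (\<theta> t \<omega>) * indicator {..0} t = 0"
      using 0 unfolding past_def by (subst (asm) nn_integral_0_iff_AE) auto
    moreover have "0 < f (\<theta> t \<omega>)" for t
      using flow_invariant_mem[OF Di \<omega>] that by (intro pos) simp
    \<comment> \<open>Positivity along the orbit leaves no time t \<le> 0 where the integrand
      vanishes; any subset of \<open>{..0}\<close> of positive measure gives the
      contradiction.\<close>
    ultimately have "AE t in lborel. t \<notin> {-1..0::real}"
      by (auto elim!: eventually_mono simp: indicator_def split: if_splits) (metis less_irrefl)
    then have "emeasure lborel {-1..0::real} = 0"
      by (subst (asm) AE_iff_measurable[where N = "{-1..0}"]) auto
    then show False by simp
  qed
  have ae: "AE \<omega> in M. \<omega> \<notin> B"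
    using g0
  proof eventually_elim
    case (elim \<omega>)
    show ?case
    proof
      assume "\<omega> \<in> B"
      then show False
        using elim nz[of \<omega>] by (simp add: g_def min_def B_def split: if_splits)
    qed
  qed
  have "AE \<omega> in M. \<omega> \<in> D" using D1 by (simp add: AE_in_set_eq_1)
  with ae have "AE \<omega> in M. \<omega> \<in> {\<omega> \<in> D. past f 0 \<omega> = \<infinity>}"
    by eventually_elim (use Dsp in \<open>auto simp: B_def\<close>)
  moreover have sets: "{\<omega> \<in> D. past f 0 \<omega> = \<infinity>} \<in> sets M"
  proof -
    have "{\<omega> \<in> D. past f 0 \<omega> = \<infinity>} = {\<omega> \<in> space M. \<omega> \<in> D \<and> past f 0 \<omega> = \<infinity>}" using Dsp by auto
    also have "\<dots> \<in> sets M" by measurable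
    finally show ?thesis .
  qed
  ultimately have "prob {\<omega> \<in> D. past f 0 \<omega> = \<infinity>} = 1" by (subst (asm) AE_in_set_eq_1) auto
  moreover have "flow_invariant M \<theta> {\<omega> \<in> D. past f 0 \<omega> = \<infinity>}"
    unfolding flow_invariant_def using Dsp inv flow_invariant_mem[OF Di] by auto
  ultimately show ?thesis using sets by (simp add: full_invariant_def)
qed

end

end

text \<open>\<open>F \<omega> u\<close> is measurable only on the event that \<open>u\<close> lies
  in the domain of \<open>F \<omega>\<close>. By \<open>le\<close> this event contains
  \<open>?A\<close>, outside which the cut-off is 0.\<close>

lemma measurable_cutoff:
  assumes \<sigma>: "continuous_on UNIV \<sigma>" and \<rho> [measurable]: "\<rho> \<in> borel_measurable M"
    and le: "\<And>\<omega>. \<omega> \<in> space M \<Longrightarrow> 2 * \<rho> \<omega> \<le> \<rho>\<^sub>0 \<omega>"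
    and F: "(\<lambda>\<omega>. F \<omega> u) \<in> borel_measurable (restrict_space M {\<omega> \<in> space M. norm u < \<rho>\<^sub>0 \<omega>})"
  shows "(\<lambda>\<omega>. cutoff \<sigma> \<rho> F \<omega> u :: 'h::{real_normed_vector,second_countable_topology}) \<in> borel_measurable M"
proof -
  let ?A = "{\<omega> \<in> space M. norm u < 2 * \<rho> \<omega>}"
  have A: "?A \<in> sets M" by measurable
  have "(\<lambda>\<omega>. F \<omega> u) \<in> borel_measurable (restrict_space M ?A)"
    by (rule measurable_restrict_mono[OF F]) (use le in fastforce)
  moreover have "(\<lambda>\<omega>. \<sigma> (norm u / \<rho> \<omega>)) \<in> borel_measurable M"
    by (rule borel_measurable_continuous_on[OF \<sigma>]) measurable
  then have "(\<lambda>\<omega>. \<sigma> (norm u / \<rho> \<omega>)) \<in> borel_measurable (restrict_space M ?A)"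
    by (rule measurable_restrict_space1)
  ultimately have "(\<lambda>\<omega>. \<sigma> (norm u / \<rho> \<omega>) *\<^sub>R F \<omega> u) \<in> borel_measurable (restrict_space M ?A)"
    by (intro borel_measurable_scaleR)
  then have "(\<lambda>\<omega>. indicator ?A \<omega> *\<^sub>R (\<sigma> (norm u / \<rho> \<omega>) *\<^sub>R F \<omega> u)) \<in> borel_measurable M"
    using A by (subst borel_measurable_restrict_space_iff[symmetric]) auto
  moreover have "cutoff \<sigma> \<rho> F \<omega> u = indicator ?A \<omega> *\<^sub>R (\<sigma> (norm u / \<rho> \<omega>) *\<^sub>R F \<omega> u)"
    if "\<omega> \<in> space M" for \<omega>
    using that by (simp add: cutoff_def)
  ultimately show ?thesis by (subst measurable_cong) auto
qed

lemma (in ergodic_mds) measurable_generated_orbit: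
  assumes rds: "generated_linear_rds M \<theta> domA A U" and \<omega>: "\<omega> \<in> space M"
    and z: "z \<in> borel_measurable borel"
  shows "(\<lambda>\<tau>. indicator {..t} \<tau> *\<^sub>R U (t - \<tau>) (\<theta> \<tau> \<omega>) (z \<tau>)) \<in> borel_measurable borel"
proof -
  have U: "(\<lambda>(t, \<omega>, x). U t \<omega> x) \<in> borel_measurable (restrict_space borel {0..} \<Otimes>\<^sub>M M \<Otimes>\<^sub>M borel)"
    using rds by (simp add: generated_linear_rds_def)
  \<comment> \<open>Joint measurability of \<open>U\<close> is given for nonnegative times;
    \<open>max\<close> redirects the times that the indicator discards.\<close>
  have "(\<lambda>\<tau>. max 0 (t - \<tau>)) \<in> borel \<rightarrow>\<^sub>M restrict_space borel {0..}"
    by (rule measurable_restrict_space2) auto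
  then have "(\<lambda>\<tau>. (max 0 (t - \<tau>), \<theta> \<tau> \<omega>, z \<tau>)) \<in> borel \<rightarrow>\<^sub>M restrict_space borel {0..} \<Otimes>\<^sub>M M \<Otimes>\<^sub>M borel"
    using measurable_orbit[OF \<omega>] z by (intro measurable_Pair)
  from measurable_compose[OF this U]
  have [measurable]: "(\<lambda>\<tau>. U (max 0 (t - \<tau>)) (\<theta> \<tau> \<omega>) (z \<tau>)) \<in> borel_measurable borel"
    by simp
  have "(\<lambda>\<tau>. indicator {..t} \<tau> *\<^sub>R U (t - \<tau>) (\<theta> \<tau> \<omega>) (z \<tau>))
      = (\<lambda>\<tau>. indicator {..t} \<tau> *\<^sub>R U (max 0 (t - \<tau>)) (\<theta> \<tau> \<omega>) (z \<tau>))"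
    by (auto simp: fun_eq_iff indicator_def max_def)
  also have "\<dots> \<in> borel_measurable borel" by measurable
  finally show ?thesis .
qed

text \<open>If the quantity stayed at least \<open>e\<close> before \<open>t\<close>, then
  \<open>inverse k\<close> would be bounded by \<open>exp (\<delta> * s) / e\<close> there, which is
  integrable over the past.\<close>

lemma (in ergodic_mds) past_infinite_imp_subexponential:
  assumes \<omega>: "\<omega> \<in> space M" and k: "\<And>t. 0 < k (\<theta> t \<omega>)" and f: "\<And>t. f (\<theta> t \<omega>) = ennreal (inverse (k (\<theta> t \<omega>)))"
    and inf: "\<And>s. past f s \<omega> = \<infinity>" and \<delta>: "0 < \<delta>" and e: "0 < e"
  shows "\<exists>s\<le>t. k (\<theta> s \<omega>) * exp (\<delta> * s) < e"
proof (rule ccontr)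
  assume "\<not> ?thesis"
  then have ge: "e \<le> k (\<theta> s \<omega>) * exp (\<delta> * s)" if "s \<le> t" for s
    using that by force
  have *: "f (\<theta> s \<omega>) \<le> ennreal (1 / e * exp (- \<delta> * \<bar>0 - s\<bar>))" if "s \<le> min t 0" for s
  proof -
    have "inverse (k (\<theta> s \<omega>)) \<le> exp (\<delta> * s) / e"
      using ge[of s] k[of s] e that by (simp add: field_simps)
    then show ?thesis using that by (simp add: f ennreal_leI)
  qed
  have "past f (min t 0) \<omega> \<le> (\<integral>\<^sup>+ s. ennreal (1 / e * exp (- \<delta> * \<bar>0 - s\<bar>)) \<partial>lborel)"
    unfolding past_def using * by (intro nn_integral_mono) (auto simp: indicator_def)
  also have "\<dots> = ennreal (1 / e * (2 / \<delta>))"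
  proof -
    have "has_bochner_integral lborel (\<lambda>s. 1 / e * exp (- \<delta> * \<bar>0 - s\<bar>)) (1 / e * (2 / \<delta>))"
      by (intro has_bochner_integral_mult_right has_bochner_integral_exp_abs \<delta>)
    then show ?thesis
      using e by (subst nn_integral_eq_integral) (auto simp: has_bochner_integral_iff)
  qed
  finally show False using inf[of "min t 0"] by (simp add: top_unique)
qed

section \<open>Dichotomy along an orbit\<close>

text \<open>One orbit is fixed. Of the cut-off nonlinearity, \<open>g\<close> keeps its
  measurability, its zero and the Lipschitz constant that the bound on \<rho> yields.\<close>

locale pseudo_hyperbolic_orbit = ergodic_mds M \<theta>
  for M :: "'w measure" and \<theta> :: "real \<Rightarrow> 'w \<Rightarrow> 'w" +
  fixes domA :: "'w \<Rightarrow> 'h::{real_inner,banach,second_countable_topology} set"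
    and A :: "'w \<Rightarrow> 'h \<Rightarrow> 'h"
    and U :: "real \<Rightarrow> 'w \<Rightarrow> 'h \<Rightarrow>\<^sub>L 'h"
    and \<Omega>' :: "'w set" and Es Eu :: "'w \<Rightarrow> 'h set" and Ps Pu :: "'w \<Rightarrow> 'h \<Rightarrow>\<^sub>L 'h"
    and \<alpha> \<beta> K :: "'w \<Rightarrow> real" and g :: "'w \<Rightarrow> 'h \<Rightarrow> 'h"
    and \<omega> :: 'w
  assumes rds: "generated_linear_rds M \<theta> domA A U"
    and hyp: "pseudo_hyperbolic M \<theta> U \<Omega>' Es Eu Ps Pu \<alpha> \<beta> K"
    and g_meas: "\<And>u. (\<lambda>\<omega>. g \<omega> u) \<in> borel_measurable M"
    and g_zero: "\<And>\<omega>. \<omega> \<in> \<Omega>' \<Longrightarrow> g \<omega> 0 = 0"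
    and g_lip: "\<And>\<omega> u v. \<omega> \<in> \<Omega>' \<Longrightarrow>
      norm (g \<omega> u - g \<omega> v) \<le> (\<alpha> \<omega> - \<beta> \<omega>) / (8 * K \<omega>) * norm (u - v)"
    and \<omega>: "\<omega> \<in> \<Omega>'"
    and K_sub: "\<And>t \<delta> e. 0 < \<delta> \<Longrightarrow> 0 < e \<Longrightarrow> \<exists>s\<le>t. K (\<theta> s \<omega>) * exp (\<delta> * s) < e"
begin

text \<open>Weighting by \<open>exp (- \<gamma> * t)\<close> shifts the rates \<beta> < \<alpha> to
  the symmetric pair -\<delta> < \<delta>.\<close>

definition \<gamma> :: real where "\<gamma> = (\<alpha> \<omega> + \<beta> \<omega>) / 2"
definition \<delta> :: real where "\<delta> = (\<alpha> \<omega> - \<beta> \<omega>) / 2"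

definition V :: "real \<Rightarrow> real \<Rightarrow> 'h \<Rightarrow>\<^sub>L 'h" where
  "V t s = exp (- \<gamma> * (t - s)) *\<^sub>R U (t - s) (\<theta> s \<omega>)"

text \<open>Meaningful for \<open>t \<le> s\<close>, where the argument of \<open>Blinfun\<close> is
  bounded linear by \<open>inverse_bounded\<close>.\<close>

definition R :: "real \<Rightarrow> real \<Rightarrow> 'h \<Rightarrow>\<^sub>L 'h" where
  "R t s = exp (- \<gamma> * (t - s)) *\<^sub>R
     Blinfun (\<lambda>x. inv_into (Eu (\<theta> t \<omega>)) (U (s - t) (\<theta> t \<omega>)) (Pu (\<theta> s \<omega>) x))"

text \<open>The two weights cancel in differences, so \<open>G t\<close> has the Lipschitz constant
  of \<open>g (\<theta> t \<omega>)\<close>.\<close>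

definition G :: "real \<Rightarrow> 'h \<Rightarrow> 'h" where
  "G t x = exp (- \<gamma> * t) *\<^sub>R g (\<theta> t \<omega>) (exp (\<gamma> * t) *\<^sub>R x)"

lemma alpha_eq: "\<alpha> \<omega> = \<gamma> + \<delta>" and beta_eq: "\<beta> \<omega> = \<gamma> - \<delta>"
  by (simp_all add: \<gamma>_def \<delta>_def field_simps)

section \<open>The splitting along the orbit\<close>

lemma Omega_invariant: "flow_invariant M \<theta> \<Omega>'"
  using hyp by (auto simp: pseudo_hyperbolic_def full_invariant_def)

lemma space: "\<omega> \<in> space M"
  using Omega_invariant \<omega> by (auto simp: flow_invariant_def)

lemma orbit: "\<theta> t \<omega> \<in> \<Omega>'"
  using flow_invariant_mem[OF Omega_invariant space] \<omega> by simp

lemma flow: "\<theta> t (\<theta> s \<omega>) = \<theta> (t + s) \<omega>"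
  using flow_add[OF space] by simp

lemmas hyp_at = hyp[unfolded pseudo_hyperbolic_def, THEN conjunct2, THEN conjunct2, THEN conjunct2,
    THEN conjunct2, THEN conjunct2, THEN conjunct2, rule_format]

lemma rates: "\<alpha> (\<theta> t \<omega>) = \<alpha> \<omega>" "\<beta> (\<theta> t \<omega>) = \<beta> \<omega>" "\<beta> \<omega> < \<alpha> \<omega>" "1 \<le> K (\<theta> t \<omega>)"
  using hyp_at[OF \<omega>] hyp_at[OF orbit] by auto

lemma splitting:
  "closed_splitting (Es (\<theta> t \<omega>)) (Eu (\<theta> t \<omega>))"
  "splitting_projections (Es (\<theta> t \<omega>)) (Eu (\<theta> t \<omega>)) (Ps (\<theta> t \<omega>)) (Pu (\<theta> t \<omega>))"
  using hyp_at[OF orbit, of t] by auto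

lemma Ps_in: "Ps (\<theta> t \<omega>) x \<in> Es (\<theta> t \<omega>)" and Pu_in: "Pu (\<theta> t \<omega>) x \<in> Eu (\<theta> t \<omega>)"
  and Ps_Pu: "Ps (\<theta> t \<omega>) x + Pu (\<theta> t \<omega>) x = x"
  using splitting(2)[of t] by (auto simp: splitting_projections_def)

lemma subspaces: "subspace (Es (\<theta> t \<omega>))" "subspace (Eu (\<theta> t \<omega>))"
  and trivial_int: "x \<in> Es (\<theta> t \<omega>) \<Longrightarrow> x \<in> Eu (\<theta> t \<omega>) \<Longrightarrow> x = 0"
  using splitting(1)[of t] by (auto simp: closed_splitting_def)

lemma projections_unique:
  assumes "y \<in> Es (\<theta> t \<omega>)" "z \<in> Eu (\<theta> t \<omega>)"
  shows "Ps (\<theta> t \<omega>) (y + z) = y" "Pu (\<theta> t \<omega>) (y + z) = z"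
proof -
  let ?d = "Ps (\<theta> t \<omega>) (y + z) - y"
  have eq: "?d = z - Pu (\<theta> t \<omega>) (y + z)"
    using Ps_Pu[of t "y + z"] by (simp add: algebra_simps)
  have "?d \<in> Es (\<theta> t \<omega>)" by (intro subspace_diff subspaces Ps_in assms)
  moreover have "?d \<in> Eu (\<theta> t \<omega>)" unfolding eq by (intro subspace_diff subspaces Pu_in assms)
  ultimately have "?d = 0" by (rule trivial_int)
  with eq show "Ps (\<theta> t \<omega>) (y + z) = y" "Pu (\<theta> t \<omega>) (y + z) = z" by auto
qed

lemma Pu_id: "z \<in> Eu (\<theta> t \<omega>) \<Longrightarrow> Pu (\<theta> t \<omega>) z = z"
  using projections_unique(2)[of 0 t z] subspaces(1)[of t] by (simp add: subspace_0)

lemma range_Pu: "range (Pu (\<theta> t \<omega>)) = Eu (\<theta> t \<omega>)"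
  using Pu_in Pu_id by (auto intro: rangeI) (metis rangeI)

section \<open>The cocycle and its inverse on the unstable subspaces\<close>

lemma U_cocycle_bundles:
  assumes "s \<le> t"
  shows "U (t - s) (\<theta> s \<omega>) ` Es (\<theta> s \<omega>) \<subseteq> Es (\<theta> t \<omega>)"
    and "U (t - s) (\<theta> s \<omega>) ` Eu (\<theta> s \<omega>) \<subseteq> Eu (\<theta> t \<omega>)"
    and hom: "homeomorphism (Eu (\<theta> s \<omega>)) (Eu (\<theta> t \<omega>)) (U (t - s) (\<theta> s \<omega>))
                (inv_into (Eu (\<theta> s \<omega>)) (U (t - s) (\<theta> s \<omega>)))"
proof -
  have "\<theta> (t - s) (\<theta> s \<omega>) = \<theta> t \<omega>" by (simp add: flow)
  with hyp_at[OF orbit, of s, THEN conjunct2, THEN conjunct2, THEN conjunct1, rule_format, of "t - s"] assms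
  show "U (t - s) (\<theta> s \<omega>) ` Es (\<theta> s \<omega>) \<subseteq> Es (\<theta> t \<omega>)"
    "U (t - s) (\<theta> s \<omega>) ` Eu (\<theta> s \<omega>) \<subseteq> Eu (\<theta> t \<omega>)"
    "homeomorphism (Eu (\<theta> s \<omega>)) (Eu (\<theta> t \<omega>)) (U (t - s) (\<theta> s \<omega>))
       (inv_into (Eu (\<theta> s \<omega>)) (U (t - s) (\<theta> s \<omega>)))"
    by simp_all
qed

lemma U_Es: "s \<le> t \<Longrightarrow> x \<in> Es (\<theta> s \<omega>) \<Longrightarrow> U (t - s) (\<theta> s \<omega>) x \<in> Es (\<theta> t \<omega>)"
  and U_Eu: "s \<le> t \<Longrightarrow> x \<in> Eu (\<theta> s \<omega>) \<Longrightarrow> U (t - s) (\<theta> s \<omega>) x \<in> Eu (\<theta> t \<omega>)"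
  using U_cocycle_bundles(1,2)[of s t] by (simp_all add: image_subset_iff)

lemma norm_U_Ps: "s \<le> t \<Longrightarrow> norm (U (t - s) (\<theta> s \<omega>) (Ps (\<theta> s \<omega>) x))
    \<le> K (\<theta> s \<omega>) * exp (\<beta> \<omega> * (t - s)) * norm x"
proof -
  assume "s \<le> t"
  then have n: "norm (U (t - s) (\<theta> s \<omega>) o\<^sub>L Ps (\<theta> s \<omega>)) \<le> K (\<theta> s \<omega>) * exp (\<beta> \<omega> * (t - s))"
    using hyp_at[OF orbit, of s, THEN conjunct2, THEN conjunct2, THEN conjunct2, THEN conjunct2,
        THEN conjunct2, THEN conjunct2, THEN conjunct1, rule_format, of "t - s"] rates(2)[of s]
    by simp
  have "norm (U (t - s) (\<theta> s \<omega>) (Ps (\<theta> s \<omega>) x))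
      \<le> norm (U (t - s) (\<theta> s \<omega>) o\<^sub>L Ps (\<theta> s \<omega>)) * norm x"
    using norm_blinfun[of "U (t - s) (\<theta> s \<omega>) o\<^sub>L Ps (\<theta> s \<omega>)" x] by simp
  also have "\<dots> \<le> K (\<theta> s \<omega>) * exp (\<beta> \<omega> * (t - s)) * norm x"
    by (intro mult_right_mono n) simp
  finally show ?thesis .
qed

lemma inverse_bounded: "t \<le> s \<Longrightarrow>
    bounded_linear (\<lambda>x. inv_into (Eu (\<theta> t \<omega>)) (U (s - t) (\<theta> t \<omega>)) (Pu (\<theta> s \<omega>) x))"
  by (rule bounded_linear_inv_into[OF subspaces(2) subspaces(2) hom Pu_in])

lemma R_apply: "t \<le> s \<Longrightarrow> R t s x = exp (- \<gamma> * (t - s)) *\<^sub>R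
    inv_into (Eu (\<theta> t \<omega>)) (U (s - t) (\<theta> t \<omega>)) (Pu (\<theta> s \<omega>) x)"
  by (simp add: R_def scaleR_blinfun.rep_eq bounded_linear_Blinfun_apply inverse_bounded)

lemma norm_R:
  assumes "t \<le> s"
  shows "norm (R t s x) \<le> K (\<theta> s \<omega>) * exp (- \<delta> * (s - t)) * norm x"
proof -
  let ?f = "\<lambda>x. inv_into (Eu (\<theta> t \<omega>)) (U (s - t) (\<theta> t \<omega>)) (Pu (\<theta> s \<omega>) x)"
  have "onorm ?f \<le> K (\<theta> s \<omega>) * exp (\<alpha> \<omega> * (t - s))"
    using hyp_at[OF orbit, of s, THEN conjunct2, THEN conjunct2, THEN conjunct2, THEN conjunct2,
        THEN conjunct2, THEN conjunct2, THEN conjunct2, rule_format, of "t - s"] assms rates(1)[of s]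
    by (simp add: flow)
  then have "norm (?f x) \<le> K (\<theta> s \<omega>) * exp (\<alpha> \<omega> * (t - s)) * norm x"
    using onorm[OF inverse_bounded[OF assms], of x]
    by (elim order_trans) (intro mult_right_mono, auto)
  then have "norm (R t s x)
      \<le> exp (- \<gamma> * (t - s)) * (K (\<theta> s \<omega>) * exp (\<alpha> \<omega> * (t - s)) * norm x)"
    by (simp add: R_apply assms)
  also have "\<dots> = K (\<theta> s \<omega>) * (exp (- \<gamma> * (t - s)) * exp (\<alpha> \<omega> * (t - s))) * norm x"
    by (simp only: mult.assoc mult.left_commute)
  also have "exp (- \<gamma> * (t - s)) * exp (\<alpha> \<omega> * (t - s)) = exp (- \<delta> * (s - t))"
    by (simp add: alpha_eq algebra_simps flip: exp_add)
  finally show ?thesis .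
qed

lemma norm_VP:
  assumes "s \<le> t"
  shows "norm (V t s (Ps (\<theta> s \<omega>) x)) \<le> K (\<theta> s \<omega>) * exp (- \<delta> * (t - s)) * norm x"
proof -
  have "norm (V t s (Ps (\<theta> s \<omega>) x))
      \<le> exp (- \<gamma> * (t - s)) * (K (\<theta> s \<omega>) * exp (\<beta> \<omega> * (t - s)) * norm x)"
    using norm_U_Ps[OF assms, of x] by (simp add: V_def scaleR_blinfun.rep_eq mult.assoc)
  also have "\<dots> = K (\<theta> s \<omega>) * (exp (- \<gamma> * (t - s)) * exp (\<beta> \<omega> * (t - s))) * norm x"
    by (simp only: mult.assoc mult.left_commute)
  also have "exp (- \<gamma> * (t - s)) * exp (\<beta> \<omega> * (t - s)) = exp (- \<delta> * (t - s))"
    by (simp add: beta_eq algebra_simps flip: exp_add)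
  finally show ?thesis .
qed

lemma rds_at:
  "fundamental_solution (\<lambda>t. domA (\<theta> t \<omega>)) (\<lambda>t. A (\<theta> t \<omega>)) (\<lambda>t s. U (t - s) (\<theta> s \<omega>))"
  using rds space by (auto simp: generated_linear_rds_def)

lemma V_comp: "r \<le> s \<Longrightarrow> s \<le> t \<Longrightarrow> V t s (V s r x) = V t r x"
proof -
  assume *: "r \<le> s" "s \<le> t"
  have "U (t - r) (\<theta> r \<omega>) = U (t - s) (\<theta> s \<omega>) o\<^sub>L U (s - r) (\<theta> r \<omega>)"
    using * by (rule rds_at[unfolded fundamental_solution_def, THEN conjunct2, THEN conjunct2,
          THEN conjunct1, rule_format])
  then have "V t s (V s r x) = (exp (- \<gamma> * (t - s)) * exp (- \<gamma> * (s - r))) *\<^sub>R U (t - r) (\<theta> r \<omega>) x"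
    by (simp add: V_def scaleR_blinfun.rep_eq blinfun.scaleR_right)
  also have "exp (- \<gamma> * (t - s)) * exp (- \<gamma> * (s - r)) = exp (- \<gamma> * (t - r))"
    by (simp add: algebra_simps flip: exp_add)
  finally show ?thesis by (simp add: V_def scaleR_blinfun.rep_eq)
qed

lemma V_cont: "continuous_on {s..} (\<lambda>t. V t s x)"
proof -
  have "continuous_on {(t, s). s \<le> t} (\<lambda>(t, s). U (t - s) (\<theta> s \<omega>) x)"
    using rds_at[unfolded fundamental_solution_def, THEN conjunct1] by blast
  then have "continuous_on {s..} (\<lambda>t. (\<lambda>(t, s). U (t - s) (\<theta> s \<omega>) x) (t, s))"
    by (rule continuous_on_compose2) (auto intro!: continuous_intros)
  then show ?thesis
    unfolding V_def scaleR_blinfun.rep_eq by (auto intro!: continuous_intros)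
qed

text \<open>Commutation is derived from invariance: \<open>U\<close> maps the two components of
  \<open>x\<close> into the two subspaces at time \<open>t\<close>, and the decomposition there is
  unique.\<close>

lemma PuU: "s \<le> t \<Longrightarrow> Pu (\<theta> t \<omega>) (U (t - s) (\<theta> s \<omega>) x) = U (t - s) (\<theta> s \<omega>) (Pu (\<theta> s \<omega>) x)"
  and PsU: "s \<le> t \<Longrightarrow> Ps (\<theta> t \<omega>) (U (t - s) (\<theta> s \<omega>) x) = U (t - s) (\<theta> s \<omega>) (Ps (\<theta> s \<omega>) x)"
proof -
  assume st: "s \<le> t"
  have "U (t - s) (\<theta> s \<omega>) x = U (t - s) (\<theta> s \<omega>) (Ps (\<theta> s \<omega>) x) + U (t - s) (\<theta> s \<omega>) (Pu (\<theta> s \<omega>) x)"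
    by (simp add: Ps_Pu flip: blinfun.add_right)
  then show "Pu (\<theta> t \<omega>) (U (t - s) (\<theta> s \<omega>) x) = U (t - s) (\<theta> s \<omega>) (Pu (\<theta> s \<omega>) x)"
    "Ps (\<theta> t \<omega>) (U (t - s) (\<theta> s \<omega>) x) = U (t - s) (\<theta> s \<omega>) (Ps (\<theta> s \<omega>) x)"
    using projections_unique[OF U_Es[OF st Ps_in] U_Eu[OF st Pu_in]] by simp_all
qed

section \<open>Measurability in time along the orbit\<close>

lemma measurable_G:
  assumes u: "u \<in> borel_measurable borel"
  shows "(\<lambda>\<tau>. G \<tau> (u \<tau>)) \<in> borel_measurable borel"
proof -
  have "(\<lambda>\<tau>. g (\<theta> \<tau> \<omega>) (exp (\<gamma> * \<tau>) *\<^sub>R u \<tau>)) \<in> borel_measurable borel"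
  proof (rule borel_measurable_Caratheodory[where f = "\<lambda>\<tau>. g (\<theta> \<tau> \<omega>)"])
    show "(\<lambda>\<tau>. g (\<theta> \<tau> \<omega>) x) \<in> borel_measurable borel" for x
      by (rule measurable_compose[OF measurable_orbit[OF space] g_meas])
    have "((\<alpha> (\<theta> \<tau> \<omega>) - \<beta> (\<theta> \<tau> \<omega>)) / (8 * K (\<theta> \<tau> \<omega>)))-lipschitz_on UNIV (g (\<theta> \<tau> \<omega>))" for \<tau>
      using g_lip[OF orbit, of \<tau>] rates(3) rates(4)[of \<tau>]
      by (intro lipschitz_onI) (auto simp: dist_norm rates(1,2))
    then show "continuous_on UNIV (g (\<theta> \<tau> \<omega>))" for \<tau>
      by (rule lipschitz_on_continuous_on)
  qed (use u in measurable)
  then show ?thesis unfolding G_def by measurable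
qed

lemma measurable_projection:
  assumes P: "\<And>x. (\<lambda>\<omega>. blinfun_apply (P \<omega>) x) \<in> borel_measurable (restrict_space M \<Omega>')"
    and z: "z \<in> borel_measurable borel"
  shows "(\<lambda>\<tau>. blinfun_apply (P (\<theta> \<tau> \<omega>)) (z \<tau> :: 'h) :: 'h) \<in> borel_measurable borel"
proof (rule borel_measurable_Caratheodory[where f = "\<lambda>\<tau>. blinfun_apply (P (\<theta> \<tau> \<omega>))", OF _ _ z])
  have "(\<lambda>\<tau>. \<theta> \<tau> \<omega>) \<in> borel \<rightarrow>\<^sub>M restrict_space M \<Omega>'"
    using orbit by (intro measurable_restrict_space2 measurable_orbit[OF space]) auto
  from measurable_compose[OF this P]
  show "(\<lambda>\<tau>. blinfun_apply (P (\<theta> \<tau> \<omega>)) x) \<in> borel_measurable borel" for x .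
qed (intro continuous_intros)

lemma measurable_V:
  assumes z: "z \<in> borel_measurable borel"
  shows "(\<lambda>\<tau>. indicator {..t} \<tau> *\<^sub>R V t \<tau> (z \<tau>)) \<in> borel_measurable borel"
proof -
  note [measurable] = measurable_generated_orbit[OF rds space z, of t]
  have "(\<lambda>\<tau>. indicator {..t} \<tau> *\<^sub>R V t \<tau> (z \<tau>)) =
      (\<lambda>\<tau>. exp (- \<gamma> * (t - \<tau>)) *\<^sub>R (indicator {..t} \<tau> *\<^sub>R U (t - \<tau>) (\<theta> \<tau> \<omega>) (z \<tau>)))"
    by (simp add: V_def scaleR_blinfun.rep_eq fun_eq_iff)
  also have "\<dots> \<in> borel_measurable borel" by measurable
  finally show ?thesis .
qed

sublocale D: backward_dichotomy V R "\<lambda>t. Ps (\<theta> t \<omega>)" "\<lambda>t. Pu (\<theta> t \<omega>)" G "\<lambda>t. K (\<theta> t \<omega>)" \<delta>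
proof
  show "0 < \<delta>" using rates by (simp add: \<delta>_def)
  show "0 < K (\<theta> t \<omega>)" for t using rates(4)[of t] by linarith
  show "V t t x = x" for t x
    using rds_at[unfolded fundamental_solution_def, THEN conjunct2, THEN conjunct1, rule_format, of t]
    by (simp add: V_def)
  show "V t s (V s r x) = V t r x" if "r \<le> s" "s \<le> t" for r s t x using that by (rule V_comp)
  show "continuous_on {s..} (\<lambda>t. V t s x)" for s x by (rule V_cont)
  show "Ps (\<theta> t \<omega>) x + Pu (\<theta> t \<omega>) x = x" for t x by (rule Ps_Pu)
  show "Ps (\<theta> t \<omega>) (V t s x) = V t s (Ps (\<theta> s \<omega>) x)" if "s \<le> t" for s t x
    using that by (simp add: V_def scaleR_blinfun.rep_eq blinfun.scaleR_right PsU)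
  fix s t :: real and x assume ts: "t \<le> s"
  let ?i = "inv_into (Eu (\<theta> t \<omega>)) (U (s - t) (\<theta> t \<omega>))"
  have i: "?i y \<in> Eu (\<theta> t \<omega>)" "U (s - t) (\<theta> t \<omega>) (?i y) = y" if "y \<in> Eu (\<theta> s \<omega>)" for y
    using hom[OF ts] that by (auto simp: homeomorphism_def)
  have iU: "?i (U (s - t) (\<theta> t \<omega>) y) = y" if "y \<in> Eu (\<theta> t \<omega>)" for y
    using hom[OF ts] that by (auto simp: homeomorphism_def)
  have exp1: "exp (- \<gamma> * (t - s)) * exp (- \<gamma> * (s - t)) = 1"
    "exp (- \<gamma> * (s - t)) * exp (- \<gamma> * (t - s)) = 1"
    by (simp_all add: algebra_simps flip: exp_add)
  have "V s t (R t s x) = (exp (- \<gamma> * (s - t)) * exp (- \<gamma> * (t - s))) *\<^sub>R Pu (\<theta> s \<omega>) x"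
    by (simp add: V_def R_apply[OF ts] scaleR_blinfun.rep_eq blinfun.scaleR_right i Pu_in)
  then show "V s t (R t s x) = Pu (\<theta> s \<omega>) x" unfolding exp1 by simp
  show "R t s (V s t x) = Pu (\<theta> t \<omega>) x"
  proof -
    have "linear (\<lambda>x. ?i (Pu (\<theta> s \<omega>) x))"
      using inverse_bounded[OF ts] by (rule bounded_linear.linear)
    note sc = linear_scale[OF this]
    have "R t s (V s t x) = (exp (- \<gamma> * (t - s)) * exp (- \<gamma> * (s - t))) *\<^sub>R
        ?i (Pu (\<theta> s \<omega>) (U (s - t) (\<theta> t \<omega>) x))"
      by (simp add: V_def R_apply[OF ts] scaleR_blinfun.rep_eq sc)
    also note exp1(1)
    finally show ?thesis using ts by (simp add: PuU iU Pu_in)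
  qed
  show "Pu (\<theta> t \<omega>) (R t s x) = R t s x"
    by (simp add: R_apply[OF ts] blinfun.scaleR_right Pu_id i Pu_in)
  show "R t s (Pu (\<theta> s \<omega>) x) = R t s x"
    by (simp add: R_apply[OF ts] Pu_id Pu_in)
  show "norm (R t s x) \<le> K (\<theta> s \<omega>) * exp (- \<delta> * (s - t)) * norm x"
    using ts by (rule norm_R)
next
  show "norm (V t s (Ps (\<theta> s \<omega>) x)) \<le> K (\<theta> s \<omega>) * exp (- \<delta> * (t - s)) * norm x"
    if "s \<le> t" for s t x using that by (rule norm_VP)
  show "G t 0 = 0" for t using g_zero[OF orbit] by (simp add: G_def)
  show "norm (G t x - G t y) \<le> \<delta> / (4 * K (\<theta> t \<omega>)) * norm (x - y)" for t x y
  proof -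
    have "norm (G t x - G t y)
        = exp (- \<gamma> * t) * norm (g (\<theta> t \<omega>) (exp (\<gamma> * t) *\<^sub>R x) - g (\<theta> t \<omega>) (exp (\<gamma> * t) *\<^sub>R y))"
      unfolding G_def by (simp flip: scaleR_diff_right)
    also have "\<dots> \<le> exp (- \<gamma> * t) *
        ((\<alpha> \<omega> - \<beta> \<omega>) / (8 * K (\<theta> t \<omega>)) * norm (exp (\<gamma> * t) *\<^sub>R x - exp (\<gamma> * t) *\<^sub>R y))"
      using g_lip[OF orbit, of t "exp (\<gamma> * t) *\<^sub>R x" "exp (\<gamma> * t) *\<^sub>R y"]
      by (intro mult_left_mono) (simp_all add: rates)
    also have "\<dots> = \<delta> / (4 * K (\<theta> t \<omega>)) * norm (x - y) * (exp (- \<gamma> * t) * exp (\<gamma> * t))"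
      by (simp add: \<delta>_def flip: scaleR_diff_right)
    also have "exp (- \<gamma> * t) * exp (\<gamma> * t) = 1" by (simp flip: exp_add)
    finally show ?thesis by simp
  qed
  have P: "\<And>x. (\<lambda>\<omega>. Ps \<omega> x) \<in> borel_measurable (restrict_space M \<Omega>')"
    and Q: "\<And>x. (\<lambda>\<omega>. Pu \<omega> x) \<in> borel_measurable (restrict_space M \<Omega>')"
    using hyp by (simp_all add: pseudo_hyperbolic_def)
  fix t and u :: "real \<Rightarrow> 'h" assume u: "u \<in> borel_measurable borel"
  show "(\<lambda>\<tau>. indicator {..t} \<tau> *\<^sub>R V t \<tau> (Ps (\<theta> \<tau> \<omega>) (G \<tau> (u \<tau>)))) \<in> borel_measurable borel"
    by (intro measurable_V measurable_projection P measurable_G u)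
  show "(\<lambda>\<tau>. indicator {..t} \<tau> *\<^sub>R V t \<tau> (Pu (\<theta> \<tau> \<omega>) (G \<tau> (u \<tau>)))) \<in> borel_measurable borel"
    by (intro measurable_V measurable_projection Q measurable_G u)
next
  show "\<exists>s\<le>t. K (\<theta> s \<omega>) * exp (\<delta> * s) < e" if "0 < e" for t e
    using K_sub[OF _ that, of \<delta> t] rates by (simp add: \<delta>_def)
qed

text \<open>Each term of the mild formula at \<open>t\<close> acquires the same factor
  \<open>exp (- \<gamma> * t)\<close>. It does not depend on \<tau>, so it leaves the integral and
  cancels.\<close>

lemma mild_rescale:
  "D.mild (\<lambda>t. exp (- \<gamma> * t) *\<^sub>R u t) \<longleftrightarrow> mild_solution_backward \<theta> U g \<omega> u"
proof -
  let ?v = "\<lambda>t. exp (- \<gamma> * t) *\<^sub>R u t"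
  have VG: "V t \<tau> (G \<tau> (?v \<tau>)) = exp (- \<gamma> * t) *\<^sub>R U (t - \<tau>) (\<theta> \<tau> \<omega>) (g (\<theta> \<tau> \<omega>) (u \<tau>))" for t \<tau>
  proof -
    have "exp (- \<gamma> * (t - \<tau>)) * exp (- \<gamma> * \<tau>) = exp (- \<gamma> * t)" and "exp (\<gamma> * \<tau>) * exp (- \<gamma> * \<tau>) = 1"
      by (simp_all add: algebra_simps flip: exp_add)
    then show ?thesis by (simp add: V_def G_def scaleR_blinfun.rep_eq blinfun.scaleR_right)
  qed
  have Vv: "V t s (?v s) = exp (- \<gamma> * t) *\<^sub>R U (t - s) (\<theta> s \<omega>) (u s)" for t s
  proof -
    have "exp (- \<gamma> * (t - s)) * exp (- \<gamma> * s) = exp (- \<gamma> * t)"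
      by (simp add: algebra_simps flip: exp_add)
    then show ?thesis by (simp add: V_def scaleR_blinfun.rep_eq blinfun.scaleR_right)
  qed
  have int: "set_integrable lborel B (\<lambda>\<tau>. exp (- \<gamma> * t) *\<^sub>R h \<tau>) \<longleftrightarrow> set_integrable lborel B h"
    for B t and h :: "real \<Rightarrow> 'h"
  proof
    assume "set_integrable lborel B (\<lambda>\<tau>. exp (- \<gamma> * t) *\<^sub>R h \<tau>)"
    from set_integrable_scaleR_right[OF this, of "exp (\<gamma> * t)"]
    show "set_integrable lborel B h" by (simp flip: exp_add)
  qed simp
  show ?thesis
    unfolding D.mild_def mild_solution_backward_def VG Vv int set_integral_scaleR_right
    by (simp only: scaleR_right_distrib[symmetric] scaleR_cancel_left exp_not_eq_zero simp_thms)
qed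

lemma weighted_space_rescale:
  "u \<in> weighted_space \<gamma> \<longleftrightarrow>
     continuous_on {..0} (\<lambda>t. exp (- \<gamma> * t) *\<^sub>R u t) \<and> bounded ((\<lambda>t. exp (- \<gamma> * t) *\<^sub>R u t) ` {..0})"
proof -
  have "continuous_on {..0} u" if "continuous_on {..0} (\<lambda>t. exp (- \<gamma> * t) *\<^sub>R u t)"
  proof -
    have "continuous_on {..0} (\<lambda>t. exp (\<gamma> * t) *\<^sub>R (exp (- \<gamma> * t) *\<^sub>R u t))"
      by (intro continuous_intros that)
    then show ?thesis by (simp flip: exp_add)
  qed
  moreover have "continuous_on {..0} (\<lambda>t. exp (- \<gamma> * t) *\<^sub>R u t)" if "continuous_on {..0} u"
    by (intro continuous_intros that)
  ultimately show ?thesis by (auto simp: weighted_space_def)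
qed

lemma pseudo_unstable_set_eq:
  "pseudo_unstable_set \<theta> U g (\<lambda>\<omega>. (\<alpha> \<omega> + \<beta> \<omega>) / 2) \<omega> =
     {v 0 | v. D.mild v \<and> continuous_on {..0} v \<and> bounded (v ` {..0})}" (is "?L = ?R")
proof (intro equalityI subsetI)
  fix x assume "x \<in> ?L"
  then obtain u where u: "mild_solution_backward \<theta> U g \<omega> u" "u 0 = x" "u \<in> weighted_space \<gamma>"
    by (auto simp: pseudo_unstable_set_def \<gamma>_def)
  then show "x \<in> ?R"
    using mild_rescale[of u] weighted_space_rescale[of u]
    by (intro CollectI exI[of _ "\<lambda>t. exp (- \<gamma> * t) *\<^sub>R u t"]) auto
next
  fix x assume "x \<in> ?R"
  then obtain v where v: "x = v 0" "D.mild v" "continuous_on {..0} v" "bounded (v ` {..0})" by auto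
  define u where "u t = exp (\<gamma> * t) *\<^sub>R v t" for t
  have "v = (\<lambda>t. exp (- \<gamma> * t) *\<^sub>R u t)" by (simp add: u_def flip: exp_add)
  with v have "mild_solution_backward \<theta> U g \<omega> u" "u \<in> weighted_space \<gamma>"
    using mild_rescale[of u] weighted_space_rescale[of u] by simp_all
  moreover have "u 0 = x" by (simp add: u_def v(1))
  ultimately show "x \<in> ?L" by (auto simp: pseudo_unstable_set_def \<gamma>_def)
qed

lemma pseudo_unstable_graph:
  "\<exists>h. h ` Eu \<omega> \<subseteq> Es \<omega> \<and> (\<exists>L. L-lipschitz_on (Eu \<omega>) h) \<and> h 0 = 0 \<and>
     pseudo_unstable_set \<theta> U g (\<lambda>\<omega>. (\<alpha> \<omega> + \<beta> \<omega>) / 2) \<omega> = {p + h p | p. p \<in> Eu \<omega>}"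
proof -
  have 0: "\<theta> 0 \<omega> = \<omega>" using flow_zero[OF space] .
  have ran: "range (Pu \<omega>) = Eu \<omega>" "range (Ps \<omega>) \<subseteq> Es \<omega>"
    using range_Pu[of 0] Ps_in[of 0] 0 by auto
  obtain h where "\<And>p. p \<in> range (Pu (\<theta> 0 \<omega>)) \<Longrightarrow> h p \<in> range (Ps (\<theta> 0 \<omega>))"
    "\<exists>L. L-lipschitz_on (range (Pu (\<theta> 0 \<omega>))) h" "h 0 = 0"
    "{v 0 | v. D.mild v \<and> continuous_on {..0} v \<and> bounded (v ` {..0})}
      = {p + h p | p. p \<in> range (Pu (\<theta> 0 \<omega>))}"
    by (rule D.bounded_mild_graph, rule that)
  then show ?thesis
    unfolding 0 ran(1) pseudo_unstable_set_eq[symmetric]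
    using ran(2) by (intro exI[of _ h]) auto
qed

end

section \<open>The pseudo-unstable manifold\<close>

theorem theorem4p1:
  fixes M :: "'w measure" and \<theta> :: "real \<Rightarrow> 'w \<Rightarrow> 'w"
    and domA :: "'w \<Rightarrow> 'h::{real_inner,banach,second_countable_topology} set"
    and A :: "'w \<Rightarrow> 'h \<Rightarrow> 'h"
    and U :: "real \<Rightarrow> 'w \<Rightarrow> 'h \<Rightarrow>\<^sub>L 'h"
    and \<Omega>' :: "'w set" and Es Eu :: "'w \<Rightarrow> 'h set" and Ps Pu :: "'w \<Rightarrow> 'h \<Rightarrow>\<^sub>L 'h"
    and \<alpha> \<beta> K \<rho>\<^sub>0 B\<^sub>0 \<rho> B\<^sub>1 :: "'w \<Rightarrow> real" and \<epsilon> :: real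
    and F :: "'w \<Rightarrow> 'h \<Rightarrow> 'h" and \<sigma> :: "real \<Rightarrow> real"
  assumes mds: "ergodic_mds M \<theta>"
    and rds: "generated_linear_rds M \<theta> domA A U"
    and hyp: "pseudo_hyperbolic M \<theta> U \<Omega>' Es Eu Ps Pu \<alpha> \<beta> K"
    and rho0: "tempered_below M \<theta> (space M) \<rho>\<^sub>0" "orbit_locally_integrable M \<theta> \<rho>\<^sub>0"
    and eps: "0 < \<epsilon>" "\<epsilon> \<le> 1"
    and B0: "tempered_above M \<theta> (space M) B\<^sub>0" "orbit_locally_integrable M \<theta> B\<^sub>0"
    and F_meas: "\<And>u. (\<lambda>\<omega>. F \<omega> u)
                   \<in> borel_measurable (restrict_space M {\<omega> \<in> space M. norm u < \<rho>\<^sub>0 \<omega>})"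
    and F_lip: "\<And>\<omega>. \<omega> \<in> space M \<Longrightarrow> \<exists>L. L-lipschitz_on {u. norm u < \<rho>\<^sub>0 \<omega>} (F \<omega>)"
    and F_zero: "\<And>\<omega>. \<omega> \<in> space M \<Longrightarrow> F \<omega> 0 = 0"
    and F_est: "\<And>\<omega> u v. \<lbrakk>\<omega> \<in> space M; norm u < \<rho>\<^sub>0 \<omega>; norm v < \<rho>\<^sub>0 \<omega>\<rbrakk> \<Longrightarrow>
                  norm (F \<omega> u - F \<omega> v)
                    \<le> B\<^sub>0 \<omega> * (norm u powr \<epsilon> + norm v powr \<epsilon>) * norm (u - v)"
    and sigma: "cutoff_function \<sigma>"
    and rho: "tempered_below M \<theta> (space M) \<rho>" "orbit_locally_integrable M \<theta> \<rho>"
             "\<And>\<omega>. \<omega> \<in> space M \<Longrightarrow> 2 * \<rho> \<omega> \<le> \<rho>\<^sub>0 \<omega>"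
    and B1: "tempered_above M \<theta> (space M) B\<^sub>1" "orbit_locally_integrable M \<theta> B\<^sub>1"
    and cutoff_lip: "\<And>\<omega> u v. \<omega> \<in> space M \<Longrightarrow>
                  norm (cutoff \<sigma> \<rho> F \<omega> u - cutoff \<sigma> \<rho> F \<omega> v)
                    \<le> B\<^sub>1 \<omega> * \<rho> \<omega> powr \<epsilon> * norm (u - v)"
    and small: "\<And>\<omega>. \<omega> \<in> \<Omega>' \<Longrightarrow>
                  0 < \<rho> \<omega> \<and> \<rho> \<omega> < ((\<alpha> \<omega> - \<beta> \<omega>) / (8 * K \<omega> * B\<^sub>1 \<omega>)) powr (1 / \<epsilon>)"
  shows "\<exists>\<Omega>''\<subseteq>\<Omega>'. full_invariant M \<theta> \<Omega>'' \<and>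
           (\<exists>h. \<forall>\<omega>\<in>\<Omega>''.
              h \<omega> ` Eu \<omega> \<subseteq> Es \<omega> \<and>
              (\<exists>L. L-lipschitz_on (Eu \<omega>) (h \<omega>)) \<and>
              h \<omega> 0 = 0 \<and>
              pseudo_unstable_set \<theta> U (cutoff \<sigma> \<rho> F) (\<lambda>\<omega>. (\<alpha> \<omega> + \<beta> \<omega>) / 2) \<omega>
                = {p + h \<omega> p | p. p \<in> Eu \<omega>})"
proof -
  interpret ergodic_mds M \<theta> by (rule mds)
  \<comment> \<open>\<open>K\<close> is controlled on \<open>\<Omega>'\<close> only, hence the
    extension by 0; \<open>1 \<le> K\<close> gives the bound by 1 that
    \<open>past_infinite_iff\<close> requires.\<close>
  let ?f = "\<lambda>\<omega>. if \<omega> \<in> \<Omega>' then ennreal (inverse (K \<omega>)) else 0"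
  let ?\<Omega> = "{\<omega> \<in> \<Omega>'. past ?f 0 \<omega> = \<infinity>}"
  have full: "full_invariant M \<theta> \<Omega>'" and K_meas: "K \<in> borel_measurable (restrict_space M \<Omega>')"
    using hyp by (simp_all add: pseudo_hyperbolic_def tempered_above_def)
  then have inv: "flow_invariant M \<theta> \<Omega>'" and \<Omega>'_sets: "\<Omega>' \<in> sets M" and \<Omega>'_space: "\<Omega>' \<subseteq> space M"
    by (auto simp: full_invariant_def flow_invariant_def)
  have K1: "1 \<le> K \<omega>" if "\<omega> \<in> \<Omega>'" for \<omega>
    using hyp that by (simp add: pseudo_hyperbolic_def)
  have f: "?f \<in> borel_measurable M"
  proof -
    have "(\<lambda>\<omega>. ennreal (inverse (K \<omega>))) \<in> borel_measurable (restrict_space M \<Omega>')"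
      using K_meas by measurable
    then have "(\<lambda>\<omega>. ennreal (inverse (K \<omega>)) * indicator \<Omega>' \<omega>) \<in> borel_measurable M"
      using \<Omega>'_sets by (subst borel_measurable_restrict_space_iff_ennreal[symmetric]) auto
    also have "(\<lambda>\<omega>. ennreal (inverse (K \<omega>)) * indicator \<Omega>' \<omega>) = ?f"
      by (auto simp: indicator_def)
    finally show ?thesis .
  qed
  have f_le: "?f \<omega> \<le> 1" for \<omega>
    using K1[of \<omega>] by (auto simp: ennreal_le_1 inverse_le_1_iff)
  have f_pos: "0 < ?f \<omega>" if "\<omega> \<in> \<Omega>'" for \<omega>
    using less_le_trans[OF zero_less_one K1[OF that]] that by simp
  have full': "full_invariant M \<theta> ?\<Omega>"
    by (rule full_invariant_past_infinite[OF f full f_pos f_le])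
  have "continuous_on UNIV \<sigma>"
  proof -
    have "\<sigma> differentiable (at x)" for x
      using sigma unfolding cutoff_function_def by (metis funpow_0)
    then show ?thesis
      by (simp add: continuous_at_imp_continuous_on differentiable_imp_continuous_within)
  qed
  moreover have "\<rho> \<in> borel_measurable M"
  proof -
    have "sets (restrict_space M (space M)) = sets M"
      by (auto simp: sets_restrict_space image_iff)
    then have "borel_measurable (restrict_space M (space M)) = (borel_measurable M :: ('w \<Rightarrow> real) set)"
      by (rule measurable_cong_sets) simp
    then show ?thesis using rho(1) by (simp add: tempered_below_def)
  qed
  ultimately have cutoff_meas: "(\<lambda>\<omega>. cutoff \<sigma> \<rho> F \<omega> u) \<in> borel_measurable M" for u
    by (rule measurable_cutoff[OF _ _ rho(3) F_meas])
  have "pseudo_hyperbolic_orbit M \<theta> domA A U \<Omega>' Es Eu Ps Pu \<alpha> \<beta> K (cutoff \<sigma> \<rho> F) \<omega>" if \<omega>: "\<omega> \<in> ?\<Omega>" for \<omega>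
  proof
    show "cutoff \<sigma> \<rho> F \<omega> 0 = 0" if "\<omega> \<in> \<Omega>'" for \<omega>
      using F_zero[of \<omega>] that \<Omega>'_space by (auto simp: cutoff_def)
    show "norm (cutoff \<sigma> \<rho> F \<omega> u - cutoff \<sigma> \<rho> F \<omega> v)
        \<le> (\<alpha> \<omega> - \<beta> \<omega>) / (8 * K \<omega>) * norm (u - v)" if \<omega>: "\<omega> \<in> \<Omega>'" for \<omega> u v
    proof -
      \<comment> \<open>Raising the smallness condition to the power \<epsilon> bounds
        \<open>\<rho> \<omega> powr \<epsilon>\<close> by \<open>X\<close>, and the factor
        \<open>B\<^sub>1 \<omega>\<close> then cancels the one in the denominator of
        \<open>X\<close>.\<close>
      define X where "X = (\<alpha> \<omega> - \<beta> \<omega>) / (8 * K \<omega> * B\<^sub>1 \<omega>)"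
      have sp: "\<omega> \<in> space M" using \<omega> \<Omega>'_space by auto
      have B: "0 < B\<^sub>1 \<omega>" using B1(1) sp by (simp add: tempered_above_def)
      have "\<beta> \<omega> < \<alpha> \<omega>" using hyp \<omega> by (simp add: pseudo_hyperbolic_def)
      then have X: "0 < X" using B K1[OF \<omega>] by (simp add: X_def)
      have "\<rho> \<omega> powr \<epsilon> \<le> (X powr (1 / \<epsilon>)) powr \<epsilon>"
        using small[OF \<omega>] eps by (intro powr_mono2) (auto simp: X_def)
      also have "\<dots> = X" using eps X by (simp add: powr_powr)
      finally have "B\<^sub>1 \<omega> * \<rho> \<omega> powr \<epsilon> \<le> B\<^sub>1 \<omega> * X" using B by (intro mult_left_mono) auto
      also have "\<dots> = (\<alpha> \<omega> - \<beta> \<omega>) / (8 * K \<omega>)" using B by (simp add: X_def)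
      finally show ?thesis
        using cutoff_lip[OF sp, of u v] mult_right_mono[OF _ norm_ge_zero] by (meson order_trans)
    qed
    show "\<omega> \<in> \<Omega>'" using \<omega> by simp
    have sp: "\<omega> \<in> space M" using \<omega> \<Omega>'_space by auto
    have orbit: "\<theta> t \<omega> \<in> \<Omega>'" for t using flow_invariant_mem[OF inv sp] \<omega> by simp
    have "past ?f s \<omega> = \<infinity>" for s
      using past_infinite_iff[OF f f_le sp, of 0 s] past_infinite_iff[OF f f_le sp, of s 0] \<omega>
      by (cases "0 \<le> s") auto
    then show "\<exists>s\<le>t. K (\<theta> s \<omega>) * exp (\<delta> * s) < e" if "0 < \<delta>" "0 < e" for t \<delta> e
      by (intro past_infinite_imp_subexponential[where f = ?f and k = K] sp that)
        (use orbit K1 in \<open>auto intro: less_le_trans[OF zero_less_one]\<close>)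
  qed (use rds hyp cutoff_meas in auto)
  then have "\<exists>h. \<forall>\<omega>\<in>?\<Omega>. h \<omega> ` Eu \<omega> \<subseteq> Es \<omega> \<and> (\<exists>L. L-lipschitz_on (Eu \<omega>) (h \<omega>)) \<and> h \<omega> 0 = 0 \<and>
      pseudo_unstable_set \<theta> U (cutoff \<sigma> \<rho> F) (\<lambda>\<omega>. (\<alpha> \<omega> + \<beta> \<omega>) / 2) \<omega> = {p + h \<omega> p | p. p \<in> Eu \<omega>}"
    \<comment> \<open>The graph maps exist for each \<omega> separately; \<open>bchoice\<close>
      assembles them into one family.\<close>
    by (intro bchoice ballI pseudo_hyperbolic_orbit.pseudo_unstable_graph)
  then show ?thesis using full' by (intro exI[of _ ?\<Omega>]) auto
qed

end
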